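(* Let $\mathbb{F}\in\{\mathbb{R},\mathbb{C},\mathbb{H}\}$, $d=\dim_{\mathbb{R}}\mathbb{F}$, let $1\le n\le m-1$ be integers, and put $N=m+dm(m-1)/2$ and $r=\sqrt{\frac{n(m-n)}{2m}}$. (a) The Grassmannians $G(n,m;\mathbb{F})$ and $G(m-n,m;\mathbb{F})$ can be embedded simultaneously as a pair of minimal submanifolds of the same sphere $S^{N-2}(r)$, and their images are opposite (each is the image of the other under $x\mapsto -x$). (b) There are two opposite cones associated with $G(n,m;\mathbb{F})$ in $(N-1)$-dimensional Euclidean space: one is the cone over the embedding $P\mapsto P-\frac nm I$ ($P\in G(n,m;\mathbb{F})$), and the other is the cone over the inverse embedding $P^\perp-\frac{m-n}{m}I$.
   Context: $H(m;\mathbb{F})=\{A\in M(m;\mathbb{F}): A^*=A\}$ is the $N$-dimensional real vector space of $m\times m$ Hermitian matrices over $\mathbb{F}$, with Euclidean inner product $g(A,B)=\frac12\mathrm{Re}\,\mathrm{tr}(AB)$. The $(N-1)$-dimensional Euclidean space is the hyperplane $\{X\in H(m;\mathbb{F}):\mathrm{tr}X=0\}$, and $S^{N-2}(r)$ is its sphere of radius $r$ about $0$. Grassmannians are identified with sets of Hermitian orthogonal projectors: $G(n,m;\mathbb{F})=\{P\in H(m;\mathbb{F}): P^2=P,\ \mathrm{tr}\,P=n\}$. For $P\in G(n,m;\mathbb{F})$ the projector onto a subspace $L$, $P^\perp=I-P\in G(m-n,m;\mathbb{F})$ is the projector onto $L^\perp$. The cone over a subset $M$ of a sphere about $0$ is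 $\{tx:x\in M,\ t\ge0\}$; two cones are opposite if one is the image of the other under $x\mapsto-x$. *)

theory Defs
  imports "HOL-Analysis.Analysis"
begin

datatype quat = Quat (qRe: real) (qIm1: real) (qIm2: real) (qIm3: real)

lemma quat_eqI:
  "qRe p = qRe q \<Longrightarrow> qIm1 p = qIm1 q \<Longrightarrow> qIm2 p = qIm2 q \<Longrightarrow> qIm3 p = qIm3 q \<Longrightarrow> p = q"
  by (rule quat.expand) simp

lemma quat_eq_iff:
  "p = q \<longleftrightarrow> qRe p = qRe q \<and> qIm1 p = qIm1 q \<and> qIm2 p = qIm2 q \<and> qIm3 p = qIm3 q"
  by (auto intro: quat_eqI)

definition qcnj :: "quat \<Rightarrow> quat"
  where "qcnj q = Quat (qRe q) (- qIm1 q) (- qIm2 q) (- qIm3 q)"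

instantiation quat :: ring_1
begin

definition zero_quat where "0 = Quat 0 0 0 0"
definition one_quat where "1 = Quat 1 0 0 0"
definition plus_quat where
  "p + q = Quat (qRe p + qRe q) (qIm1 p + qIm1 q) (qIm2 p + qIm2 q) (qIm3 p + qIm3 q)"
definition minus_quat where
  "p - q = Quat (qRe p - qRe q) (qIm1 p - qIm1 q) (qIm2 p - qIm2 q) (qIm3 p - qIm3 q)"
definition uminus_quat where
  "- q = Quat (- qRe q) (- qIm1 q) (- qIm2 q) (- qIm3 q)"
definition times_quat where
  "p * q = Quat
    (qRe p * qRe q - qIm1 p * qIm1 q - qIm2 p * qIm2 q - qIm3 p * qIm3 q)
    (qRe p * qIm1 q + qIm1 p * qRe q + qIm2 p * qIm3 q - qIm3 p * qIm2 q)
    (qRe p * qIm2 q - qIm1 p * qIm3 q + qIm2 p * qRe q + qIm3 p * qIm1 q)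
    (qRe p * qIm3 q + qIm1 p * qIm2 q - qIm2 p * qIm1 q + qIm3 p * qRe q)"

instance
  by standard
    (simp_all add: quat_eq_iff zero_quat_def one_quat_def plus_quat_def minus_quat_def
      uminus_quat_def times_quat_def algebra_simps)

end

lemma quat_sel_simps [simp]:
  "qRe 0 = 0" "qIm1 0 = 0" "qIm2 0 = 0" "qIm3 0 = 0"
  "qRe 1 = 1" "qIm1 1 = 0" "qIm2 1 = 0" "qIm3 1 = 0"
  "qRe (p + q) = qRe p + qRe q" "qIm1 (p + q) = qIm1 p + qIm1 q"
  "qIm2 (p + q) = qIm2 p + qIm2 q" "qIm3 (p + q) = qIm3 p + qIm3 q"
  "qRe (p - q) = qRe p - qRe q" "qIm1 (p - q) = qIm1 p - qIm1 q"
  "qIm2 (p - q) = qIm2 p - qIm2 q" "qIm3 (p - q) = qIm3 p - qIm3 q"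
  "qRe (- q) = - qRe q" "qIm1 (- q) = - qIm1 q" "qIm2 (- q) = - qIm2 q" "qIm3 (- q) = - qIm3 q"
  "qRe (qcnj q) = qRe q" "qIm1 (qcnj q) = - qIm1 q"
  "qIm2 (qcnj q) = - qIm2 q" "qIm3 (qcnj q) = - qIm3 q"
  by (simp_all add: zero_quat_def one_quat_def plus_quat_def minus_quat_def uminus_quat_def
      qcnj_def)

lemma quat_times_sel:
  "qRe (p * q) = qRe p * qRe q - qIm1 p * qIm1 q - qIm2 p * qIm2 q - qIm3 p * qIm3 q"
  "qIm1 (p * q) = qRe p * qIm1 q + qIm1 p * qRe q + qIm2 p * qIm3 q - qIm3 p * qIm2 q"
  "qIm2 (p * q) = qRe p * qIm2 q - qIm1 p * qIm3 q + qIm2 p * qRe q + qIm3 p * qIm1 q"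
  "qIm3 (p * q) = qRe p * qIm3 q + qIm1 p * qIm2 q - qIm2 p * qIm1 q + qIm3 p * qRe q"
  by (simp_all add: times_quat_def)

instantiation quat :: real_inner
begin

definition scaleR_quat where
  "r *\<^sub>R q = Quat (r * qRe q) (r * qIm1 q) (r * qIm2 q) (r * qIm3 q)"
definition inner_quat where
  "inner p q = qRe p * qRe q + qIm1 p * qIm1 q + qIm2 p * qIm2 q + qIm3 p * qIm3 q"
definition norm_quat where "norm (q::quat) = sqrt (inner q q)"
definition sgn_quat where "sgn (q::quat) = inverse (norm q) *\<^sub>R q"
definition dist_quat where "dist (p::quat) q = norm (p - q)"
definition uniformity_quat where
  "(uniformity :: (quat \<times> quat) filter) = (INF e\<in>{0<..}. principal {(x, y). dist x y < e})"
definition open_quat where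
  "open (U :: quat set) \<longleftrightarrow> (\<forall>x\<in>U. eventually (\<lambda>(x', y). x' = x \<longrightarrow> y \<in> U) uniformity)"

instance
proof
  fix x y z :: quat and r :: real
  show "0 \<le> inner x x" by (simp add: inner_quat_def)
  have "inner x x = 0 \<longleftrightarrow> (qRe x)\<^sup>2 + (qIm1 x)\<^sup>2 + ((qIm2 x)\<^sup>2 + (qIm3 x)\<^sup>2) = 0"
    by (simp add: inner_quat_def power2_eq_square add.assoc)
  also have "\<dots> \<longleftrightarrow> x = 0"
    by (subst add_nonneg_eq_0_iff) (auto simp: quat_eq_iff)
  finally show "inner x x = 0 \<longleftrightarrow> x = 0" .
qed (simp_all add: quat_eq_iff scaleR_quat_def inner_quat_def norm_quat_def sgn_quat_def
      dist_quat_def uniformity_quat_def open_quat_def algebra_simps)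

end

lemma quat_scaleR_sel [simp]:
  "qRe (r *\<^sub>R q) = r * qRe q" "qIm1 (r *\<^sub>R q) = r * qIm1 q"
  "qIm2 (r *\<^sub>R q) = r * qIm2 q" "qIm3 (r *\<^sub>R q) = r * qIm3 q"
  by (simp_all add: scaleR_quat_def)

instantiation quat :: real_normed_div_algebra
begin

definition inverse_quat where "inverse (q::quat) = qcnj q /\<^sub>R inner q q"
definition divide_quat where "(p::quat) div q = p * inverse q"

instance
proof
  fix x y :: quat and r :: real
  have *: "inner x x = 0 \<longleftrightarrow> x = 0" by simp
  have m: "x * qcnj x = inner x x *\<^sub>R 1" "qcnj x * x = inner x x *\<^sub>R 1"
    by (simp_all add: quat_eq_iff quat_times_sel inner_quat_def algebra_simps)
  have s: "x * (r *\<^sub>R y) = r *\<^sub>R (x * y)" "(r *\<^sub>R x) * y = r *\<^sub>R (x * y)" for x y :: quat and r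
    by (simp_all add: quat_eq_iff quat_times_sel algebra_simps)
  show "r *\<^sub>R x * y = r *\<^sub>R (x * y)" "x * r *\<^sub>R y = r *\<^sub>R (x * y)" by (simp_all add: s)
  show "x \<noteq> 0 \<Longrightarrow> inverse x * x = 1" "x \<noteq> 0 \<Longrightarrow> x * inverse x = 1"
    using * by (simp_all add: inverse_quat_def s m)
  show "x div y = x * inverse y" by (rule divide_quat_def)
  show "inverse (0::quat) = 0" by (simp add: inverse_quat_def)
  have "inner (x * y) (x * y) = inner x x * inner y y"
    by (simp add: inner_quat_def quat_times_sel algebra_simps)
  then show "norm (x * y) = norm x * norm y"
    by (simp add: norm_quat_def real_sqrt_mult)
qed

end

instantiation quat :: euclidean_space
begin

definition Basis_quat where
  "Basis = {Quat 1 0 0 0, Quat 0 1 0 0, Quat 0 0 1 0, Quat 0 0 0 1}"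

instance
proof
  fix u v x :: quat
  show "u \<in> Basis \<Longrightarrow> v \<in> Basis \<Longrightarrow> inner u v = (if u = v then 1 else 0)"
    unfolding Basis_quat_def by (elim insertE emptyE; simp add: inner_quat_def)
  show "(\<forall>u\<in>Basis. inner x u = 0) \<longleftrightarrow> x = 0"
    by (simp add: Basis_quat_def inner_quat_def) (auto simp: quat_eq_iff)
qed (simp_all add: Basis_quat_def)

end

text \<open>A type \<open>'f\<close> in this class is one of the subalgebras R, C, H of the quaternions, up to an
  isomorphism that preserves norm, conjugation \<open>fcnj\<close> and real part \<open>fRe\<close>.  The library types
  \<open>real\<close> and \<open>complex\<close> are instances below, as is \<open>quat\<close>; so a theorem about \<open>'f :: rch\<close> is a
  theorem about exactly these three.\<close>

class rch = real_normed_div_algebra + euclidean_space +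
  fixes fcnj :: "'a \<Rightarrow> 'a" and fRe :: "'a \<Rightarrow> real"
  assumes rch_embedding:
    "\<exists>\<phi> :: 'a \<Rightarrow> quat. (\<forall>x y. \<phi> (x + y) = \<phi> x + \<phi> y) \<and> (\<forall>r x. \<phi> (scaleR r x) = r *\<^sub>R \<phi> x) \<and>
       (\<forall>x y. \<phi> (x * y) = \<phi> x * \<phi> y) \<and> (\<forall>x. norm (\<phi> x) = norm x) \<and>
       (\<forall>x. \<phi> (fcnj x) = qcnj (\<phi> x)) \<and> (\<forall>x. fRe x = qRe (\<phi> x)) \<and>
       range \<phi> \<in> {{q. qIm1 q = 0 \<and> qIm2 q = 0 \<and> qIm3 q = 0}, {q. qIm2 q = 0 \<and> qIm3 q = 0}, UNIV}"

instantiation real :: rch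
begin

definition fcnj_real :: "real \<Rightarrow> real" where "fcnj_real x = x"
definition fRe_real :: "real \<Rightarrow> real" where "fRe_real x = x"

instance
proof
  let ?f = "\<lambda>x. Quat x 0 0 0"
  have "range ?f = {q. qIm1 q = 0 \<and> qIm2 q = 0 \<and> qIm3 q = 0}"
    by (auto simp: image_iff quat_eq_iff)
  then show "\<exists>\<phi> :: real \<Rightarrow> quat. (\<forall>x y. \<phi> (x + y) = \<phi> x + \<phi> y) \<and>
       (\<forall>r x. \<phi> (r *\<^sub>R x) = r *\<^sub>R \<phi> x) \<and>
       (\<forall>x y. \<phi> (x * y) = \<phi> x * \<phi> y) \<and> (\<forall>x. norm (\<phi> x) = norm x) \<and>
       (\<forall>x. \<phi> (fcnj x) = qcnj (\<phi> x)) \<and> (\<forall>x. fRe x = qRe (\<phi> x)) \<and>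
       range \<phi> \<in> {{q. qIm1 q = 0 \<and> qIm2 q = 0 \<and> qIm3 q = 0}, {q. qIm2 q = 0 \<and> qIm3 q = 0}, UNIV}"
    by (intro exI[of _ ?f])
      (simp add: quat_eq_iff quat_times_sel norm_quat_def inner_quat_def fcnj_real_def fRe_real_def)
qed

end

instantiation complex :: rch
begin

definition fcnj_complex :: "complex \<Rightarrow> complex" where "fcnj_complex = cnj"
definition fRe_complex :: "complex \<Rightarrow> real" where "fRe_complex = Re"

instance
proof
  let ?f = "\<lambda>z. Quat (Re z) (Im z) 0 0"
  have "q \<in> range ?f" if "qIm2 q = 0" "qIm3 q = 0" for q
    using that by (intro image_eqI[of _ _ "Complex (qRe q) (qIm1 q)"]) (auto simp: quat_eq_iff)
  then have "range ?f = {q. qIm2 q = 0 \<and> qIm3 q = 0}"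
    by auto
  then show "\<exists>\<phi> :: complex \<Rightarrow> quat. (\<forall>x y. \<phi> (x + y) = \<phi> x + \<phi> y) \<and>
       (\<forall>r x. \<phi> (r *\<^sub>R x) = r *\<^sub>R \<phi> x) \<and>
       (\<forall>x y. \<phi> (x * y) = \<phi> x * \<phi> y) \<and> (\<forall>x. norm (\<phi> x) = norm x) \<and>
       (\<forall>x. \<phi> (fcnj x) = qcnj (\<phi> x)) \<and> (\<forall>x. fRe x = qRe (\<phi> x)) \<and>
       range \<phi> \<in> {{q. qIm1 q = 0 \<and> qIm2 q = 0 \<and> qIm3 q = 0}, {q. qIm2 q = 0 \<and> qIm3 q = 0}, UNIV}"
    by (intro exI[of _ ?f])
      (simp add: quat_eq_iff quat_times_sel norm_quat_def inner_quat_def fcnj_complex_def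
        fRe_complex_def cmod_def power2_eq_square)
qed

end

instantiation quat :: rch
begin

definition fcnj_quat :: "quat \<Rightarrow> quat" where "fcnj_quat = qcnj"
definition fRe_quat :: "quat \<Rightarrow> real" where "fRe_quat = qRe"

instance
  by standard (rule exI[of _ "\<lambda>q. q"], simp add: fcnj_quat_def fRe_quat_def)

end

lemma fcnj_add: "fcnj (x + y :: 'f::rch) = fcnj x + fcnj y"
  and fcnj_scaleR: "fcnj (r *\<^sub>R x :: 'f) = r *\<^sub>R fcnj x"
  and fcnj_one: "fcnj (1 :: 'f) = 1"
  and fRe_add: "fRe (x + y :: 'f) = fRe x + fRe y"
  and fRe_mult_commute: "fRe (x * y :: 'f) = fRe (y * x)"
  and fRe_scaleR: "fRe (r *\<^sub>R x :: 'f) = r * fRe x"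
  and fRe_mult_fcnj: "fRe (x * fcnj y :: 'f) = inner x y"
proof -
  obtain \<phi> :: "'f \<Rightarrow> quat" where a: "\<And>x y. \<phi> (x + y) = \<phi> x + \<phi> y"
    and s: "\<And>r x. \<phi> (r *\<^sub>R x) = r *\<^sub>R \<phi> x"
    and m: "\<And>x y. \<phi> (x * y) = \<phi> x * \<phi> y" and n: "\<And>x. norm (\<phi> x) = norm x"
    and c: "\<And>x. \<phi> (fcnj x) = qcnj (\<phi> x)" and r: "\<And>x. fRe x = qRe (\<phi> x)"
    using rch_embedding[where 'a='f] by (elim exE conjE) (rule that; simp)
  have z: "\<phi> 0 = 0" using a[of 0 0] by simp
  have d: "\<phi> (x - y) = \<phi> x - \<phi> y" for x y
    using a[of "x - y" y] by simp
  have inj: "x = y" if "\<phi> x = \<phi> y" for x y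
    using n[of "x - y"] that by (simp add: d)
  have one: "\<phi> 1 = 1"
  proof -
    have "\<phi> 1 \<noteq> 0" using n[of 1] by auto
    then show ?thesis using m[of 1 1] by simp
  qed
  have inn: "inner x y = inner (\<phi> x) (\<phi> y)" for x y
    using n[of "x + y"] n[of x] n[of y] by (simp add: dot_norm a)
  show "fcnj (x + y) = fcnj x + fcnj y"
    by (rule inj) (simp add: c a quat_eq_iff)
  show "fcnj (r *\<^sub>R x) = r *\<^sub>R fcnj x"
    by (rule inj) (simp add: c s quat_eq_iff)
  show "fcnj (1 :: 'f) = 1"
    by (rule inj) (simp add: c one quat_eq_iff)
  show "fRe (x + y) = fRe x + fRe y" "fRe (r *\<^sub>R x) = r * fRe x"
    by (simp_all add: r a s)
  show "fRe (x * y) = fRe (y * x)"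
    by (simp add: r m quat_times_sel algebra_simps)
  show "fRe (x * fcnj y) = inner x y"
    by (simp add: r m c inn quat_times_sel inner_quat_def)
qed

definition ctranspose :: "'f::rch^'m^'m \<Rightarrow> 'f^'m^'m"
  where "ctranspose A = (\<chi> i j. fcnj (A $ j $ i))"

lemma subspace_hermitian: "subspace {A :: 'f::rch^'m^'m. ctranspose A = A}"
  using fcnj_scaleR[of 0 "0 :: 'f"]
  by (auto simp: subspace_def ctranspose_def vec_eq_iff fcnj_add fcnj_scaleR)

lemma ctranspose_mat_1: "ctranspose (mat 1 :: 'f::rch^'m^'m) = mat 1"
  using fcnj_scaleR[of 0 "0 :: 'f"]
  by (auto simp: ctranspose_def vec_eq_iff mat_def fcnj_one)

lemma fRe_sum: "fRe (sum f A :: 'f::rch) = (\<Sum>x\<in>A. fRe (f x))"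
  using fRe_scaleR[of 0 "0 :: 'f"]
  by (induction A rule: infinite_finite_induct) (auto simp: fRe_add)

lemma fRe_trace_mult:
  fixes A B :: "'f::rch^'m^'m"
  assumes "ctranspose B = B"
  shows "fRe (trace (A ** B)) = inner A B"
proof -
  have sym: "fcnj (B $ i $ k) = B $ k $ i" for i k
    using arg_cong[OF assms, of "\<lambda>M. M $ k $ i"] by (simp add: ctranspose_def)
  have *: "fRe (A $ i $ k * B $ k $ i) = inner (A $ i $ k) (B $ i $ k)" for i k
    using fRe_mult_fcnj[of "A $ i $ k" "B $ i $ k"] by (simp only: sym)
  show ?thesis
    by (simp add: trace_def matrix_matrix_mult_def fRe_sum inner_vec_def *)
qed

typedef (overloaded) ('f::rch, 'm::finite) herm = "{A :: 'f^'m^'m. ctranspose A = A}"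
  morphisms mat_of Herm
  using subspace_0[OF subspace_hermitian] by blast

lemma ctranspose_mat_of [simp]: "ctranspose (mat_of A) = mat_of A"
  using mat_of[of A] by simp

instantiation herm :: (rch, finite) real_inner
begin

definition zero_herm :: "('a, 'b) herm" where "0 = Herm 0"
definition plus_herm :: "('a, 'b) herm \<Rightarrow> ('a, 'b) herm \<Rightarrow> ('a, 'b) herm"
  where "A + B = Herm (mat_of A + mat_of B)"
definition minus_herm :: "('a, 'b) herm \<Rightarrow> ('a, 'b) herm \<Rightarrow> ('a, 'b) herm"
  where "A - B = Herm (mat_of A - mat_of B)"
definition uminus_herm :: "('a, 'b) herm \<Rightarrow> ('a, 'b) herm"
  where "- A = Herm (- mat_of A)"
definition scaleR_herm :: "real \<Rightarrow> ('a, 'b) herm \<Rightarrow> ('a, 'b) herm"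
  where "r *\<^sub>R A = Herm (r *\<^sub>R mat_of A)"

definition inner_herm :: "('a, 'b) herm \<Rightarrow> ('a, 'b) herm \<Rightarrow> real"
  where "inner A B = 1/2 * fRe (trace (mat_of A ** mat_of B))"

definition norm_herm where "norm (A :: ('a, 'b) herm) = sqrt (inner A A)"
definition sgn_herm where "sgn A = inverse (norm A) *\<^sub>R (A :: ('a, 'b) herm)"
definition dist_herm where "dist (A :: ('a, 'b) herm) B = norm (A - B)"
definition uniformity_herm where
  "(uniformity :: (('a, 'b) herm \<times> ('a, 'b) herm) filter) =
     (INF e\<in>{0<..}. principal {(x, y). dist x y < e})"
definition open_herm where
  "open (U :: ('a, 'b) herm set) \<longleftrightarrow>
     (\<forall>x\<in>U. eventually (\<lambda>(x', y). x' = x \<longrightarrow> y \<in> U) uniformity)"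

lemma mat_of_simps [simp]:
  fixes A B :: "('a, 'b) herm"
  shows "mat_of (0 :: ('a, 'b) herm) = 0" "mat_of (A + B) = mat_of A + mat_of B"
    "mat_of (A - B) = mat_of A - mat_of B" "mat_of (- A) = - mat_of A"
    "mat_of (r *\<^sub>R A) = r *\<^sub>R mat_of A"
proof -
  note S = subspace_hermitian[where 'f='a and 'm='b]
  show "mat_of (0 :: ('a, 'b) herm) = 0"
    unfolding zero_herm_def by (rule Herm_inverse[OF subspace_0[OF S]])
  show "mat_of (A + B) = mat_of A + mat_of B"
    unfolding plus_herm_def by (rule Herm_inverse[OF subspace_add[OF S mat_of mat_of]])
  show "mat_of (A - B) = mat_of A - mat_of B"
    unfolding minus_herm_def by (rule Herm_inverse[OF subspace_diff[OF S mat_of mat_of]])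
  show "mat_of (- A) = - mat_of A"
    unfolding uminus_herm_def by (rule Herm_inverse[OF subspace_neg[OF S mat_of]])
  show "mat_of (r *\<^sub>R A) = r *\<^sub>R mat_of A"
    unfolding scaleR_herm_def by (rule Herm_inverse[OF subspace_scale[OF S mat_of]])
qed

lemma inner_herm_eq: "inner A B = 1/2 * inner (mat_of A) (mat_of B)" for A B :: "('a, 'b) herm"
  by (simp add: inner_herm_def fRe_trace_mult)

instance
proof
  fix x y z :: "('a, 'b) herm" and r s :: real
  show "inner x y = inner y x"
    by (simp add: inner_herm_eq inner_commute)
  show "inner (x + y) z = inner x z + inner y z"
    by (simp add: inner_herm_eq inner_add_left)
  show "inner x x = 0 \<longleftrightarrow> x = 0"
    by (simp add: inner_herm_eq mat_of_inject[symmetric])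
  show "r *\<^sub>R (x + y) = r *\<^sub>R x + r *\<^sub>R y" "(r + s) *\<^sub>R x = r *\<^sub>R x + s *\<^sub>R x"
    by (simp_all add: mat_of_inject[symmetric] scaleR_add_right scaleR_add_left)
qed (simp_all add: mat_of_inject[symmetric] inner_herm_eq norm_herm_def sgn_herm_def dist_herm_def
      uniformity_herm_def open_herm_def)

end

lemma herm_orthonormal_basis_exists:
  "\<exists>B :: ('f::rch, 'm::finite) herm set. B \<noteq> {} \<and> finite B \<and>
     (\<forall>u\<in>B. \<forall>v\<in>B. inner u v = (if u = v then 1 else 0)) \<and>
     (\<forall>x. (\<forall>u\<in>B. inner x u = 0) \<longleftrightarrow> x = 0)"
proof -
  let ?S = "{A :: 'f^'m^'m. ctranspose A = A}"
  obtain C where C: "C \<subseteq> ?S" "pairwise orthogonal C" "\<And>x. x \<in> C \<Longrightarrow> norm x = 1"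
    "independent C" "span C = ?S"
    by (rule orthonormal_basis_subspace[OF subspace_hermitian[where 'f='f and 'm='m]]) (rule that)
  define B :: "('f, 'm) herm set" where "B = (\<lambda>c. sqrt 2 *\<^sub>R Herm c) ` C"
  have mC: "mat_of (Herm c) = c" if "c \<in> C" for c
    using that C(1) by (intro Herm_inverse) (rule subsetD)
  have zero: "x = 0" if x: "\<forall>u\<in>B. inner x u = 0" for x
  proof -
    have o: "orthogonal (mat_of x) c" if c: "c \<in> C" for c
    proof -
      have "inner x (sqrt 2 *\<^sub>R Herm c) = 0"
        using x c unfolding B_def by blast
      then show ?thesis
        by (simp add: inner_herm_eq mC[OF c] orthogonal_def)
    qed
    have "mat_of x \<in> span C"
      unfolding C(5) by (rule mat_of)
    then have "orthogonal (mat_of x) (mat_of x)"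
      by (rule orthogonal_to_span) (rule o)
    then have "mat_of x = 0"
      by (simp add: orthogonal_def)
    then show ?thesis
      by (simp add: mat_of_inject[symmetric])
  qed
  have "B \<noteq> {}"
  proof
    assume "B = {}"
    then have "Herm (mat 1 :: 'f^'m^'m) = 0" by (intro zero) simp
    then have "mat_of (Herm (mat 1 :: 'f^'m^'m)) = 0" by (simp only: mat_of_simps)
    moreover have "mat_of (Herm (mat 1 :: 'f^'m^'m)) = mat 1"
      by (rule Herm_inverse) (simp add: ctranspose_mat_1)
    ultimately have "(mat 1 :: 'f^'m^'m) $ undefined $ undefined = 0" by simp
    then show False by (simp add: mat_def)
  qed
  moreover have "finite B"
    using C(4) by (simp add: B_def independent_imp_finite)
  moreover have "inner u v = (if u = v then 1 else 0)" if uv: "u \<in> B" "v \<in> B" for u v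
  proof -
    obtain c d where cd: "c \<in> C" "d \<in> C" "u = sqrt 2 *\<^sub>R Herm c" "v = sqrt 2 *\<^sub>R Herm d"
      using uv unfolding B_def by blast
    have *: "inner u v = inner c d"
      using cd(3,4) by (simp add: inner_herm_eq mC[OF cd(1)] mC[OF cd(2)])
    show ?thesis
    proof (cases "c = d")
      case True
      then show ?thesis
        using * C(3)[OF cd(1)] cd(3,4) by (simp add: norm_eq_1)
    next
      case False
      then have i0: "inner c d = 0"
        using C(2) cd(1,2) by (simp add: pairwise_def orthogonal_def)
      have "u \<noteq> v"
      proof
        assume "u = v"
        then have "mat_of u = mat_of v" by simp
        with cd(3,4) False show False
          by (simp add: mC[OF cd(1)] mC[OF cd(2)])
      qed
      with * i0 show ?thesis by simp
    qed
  qed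
  moreover have "(\<forall>u\<in>B. inner x u = 0) \<longleftrightarrow> x = 0" for x
    using zero[of x] by (metis inner_zero_left)
  ultimately show ?thesis by (intro exI[of _ B] conjI ballI allI)
qed

instantiation herm :: (rch, finite) euclidean_space
begin

definition Basis_herm :: "('a, 'b) herm set" where
  "Basis_herm = (SOME B. B \<noteq> {} \<and> finite B \<and>
     (\<forall>u\<in>B. \<forall>v\<in>B. inner u v = (if u = v then 1 else 0)) \<and>
     (\<forall>x. (\<forall>u\<in>B. inner x u = 0) \<longleftrightarrow> x = 0))"

instance
proof
  have *: "(Basis :: ('a, 'b) herm set) \<noteq> {} \<and> finite (Basis :: ('a, 'b) herm set) \<and>
      (\<forall>u\<in>Basis. \<forall>v\<in>(Basis :: ('a, 'b) herm set). inner u v = (if u = v then 1 else 0)) \<and>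
      (\<forall>x :: ('a, 'b) herm. (\<forall>u\<in>Basis. inner x u = 0) \<longleftrightarrow> x = 0)"
    unfolding Basis_herm_def by (rule someI_ex[OF herm_orthonormal_basis_exists])
  fix u v x :: "('a, 'b) herm"
  show "(Basis :: ('a, 'b) herm set) \<noteq> {}" "finite (Basis :: ('a, 'b) herm set)"
    "(\<forall>u\<in>Basis. inner x u = 0) \<longleftrightarrow> x = 0"
    using * by simp_all
  show "u \<in> Basis \<Longrightarrow> v \<in> Basis \<Longrightarrow> inner u v = (if u = v then 1 else 0)"
    using * by simp
qed

end

definition herm_id :: "('f::rch, 'm::finite) herm"
  where "herm_id = Herm (mat 1)"

lemma mat_of_herm_id [simp]: "mat_of (herm_id :: ('f::rch, 'm::finite) herm) = mat 1"
  by (simp add: herm_id_def Herm_inverse ctranspose_mat_1)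

definition traceless :: "('f::rch, 'm::finite) herm set"
  where "traceless = {X. trace (mat_of X) = 0}"

definition grassmannian :: "nat \<Rightarrow> ('f::rch, 'm::finite) herm set"
  where "grassmannian n = {P. mat_of P ** mat_of P = mat_of P \<and> trace (mat_of P) = of_nat n}"

definition perp :: "('f::rch, 'm::finite) herm \<Rightarrow> ('f, 'm) herm"
  where "perp P = herm_id - P"

text \<open>Continuous differentiability of order \<open>k\<close> on an open set, by iterated directional
  derivatives (which suffices because the domain is finite-dimensional wherever this is used).\<close>

primrec ck_on :: "nat \<Rightarrow> 'a::real_normed_vector set \<Rightarrow> ('a \<Rightarrow> 'b::real_normed_vector) \<Rightarrow> bool"
  where
    "ck_on 0 U f \<longleftrightarrow> continuous_on U f"
  | "ck_on (Suc k) U f \<longleftrightarrow> (\<forall>x\<in>U. f differentiable (at x)) \<and>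
       (\<forall>v. ck_on k U (\<lambda>x. frechet_derivative f (at x) v))"

definition smooth_on :: "'a::real_normed_vector set \<Rightarrow> ('a \<Rightarrow> 'b::real_normed_vector) \<Rightarrow> bool"
  where "smooth_on U f \<longleftrightarrow> (\<forall>k. ck_on k U f)"

text \<open>Smoothness of a map on an arbitrary subset: local extendability to smooth maps on open
  sets.\<close>

definition smooth_map :: "'a::real_normed_vector set \<Rightarrow> ('a \<Rightarrow> 'b::real_normed_vector) \<Rightarrow> bool"
  where "smooth_map M f \<longleftrightarrow>
    (\<forall>x\<in>M. \<exists>U g. open U \<and> x \<in> U \<and> smooth_on U g \<and> (\<forall>y\<in>U \<inter> M. g y = f y))"

definition diffeo ::
    "'a::real_normed_vector set \<Rightarrow> 'b::real_normed_vector set \<Rightarrow> ('a \<Rightarrow> 'b) \<Rightarrow> bool"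
  where "diffeo M M' f \<longleftrightarrow> bij_betw f M M' \<and> smooth_map M f \<and> smooth_map M' (inv_into M f)"

text \<open>An embedded \<open>k\<close>-dimensional smooth submanifold (in Milnor's style): locally diffeomorphic
  to an open subset of a \<open>k\<close>-dimensional vector space \<open>T\<close>.  Since \<open>k\<close> is a number and
  not a type, \<open>T\<close> is taken among the linear subspaces of the ambient space.\<close>

definition submanifold :: "nat \<Rightarrow> 'a::euclidean_space set \<Rightarrow> bool"
  where "submanifold k M \<longleftrightarrow>
    (\<forall>p\<in>M. \<exists>U V (T :: 'a set) f. open U \<and> p \<in> U \<and> open V \<and> subspace T \<and>
       dim T = k \<and> diffeo (V \<inter> T) (U \<inter> M) f)"

definition smooth_embedding ::
    "'a::euclidean_space set \<Rightarrow> 'b::euclidean_space set \<Rightarrow> ('a \<Rightarrow> 'b) \<Rightarrow> bool"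
  where "smooth_embedding M S f \<longleftrightarrow> (\<exists>k. submanifold k M) \<and> (\<exists>k. submanifold k S) \<and>
    f ` M \<subseteq> S \<and> (\<exists>k. submanifold k (f ` M)) \<and> diffeo M (f ` M) f"

definition tangent_space :: "'a::euclidean_space set \<Rightarrow> 'a \<Rightarrow> 'a set"
  where "tangent_space M p =
    {v. \<exists>\<epsilon>>0. \<exists>\<gamma> :: real \<Rightarrow> 'a. smooth_on {-\<epsilon><..<\<epsilon>} \<gamma> \<and> \<gamma> ` {-\<epsilon><..<\<epsilon>} \<subseteq> M \<and>
       \<gamma> 0 = p \<and> (\<gamma> has_vector_derivative v) (at 0)}"

definition orth_proj :: "'a::euclidean_space set \<Rightarrow> 'a \<Rightarrow> 'a"
  where "orth_proj T x = (THE y. y \<in> T \<and> x - y \<in> T\<^sup>\<bottom>)"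

text \<open>The Levi-Civita connection of \<open>S\<close> (with the metric induced from the Euclidean space):
  the tangential part of the flat derivative.\<close>

definition covariant_derivative ::
    "'a::euclidean_space set \<Rightarrow> 'a \<Rightarrow> 'a \<Rightarrow> ('a \<Rightarrow> 'a) \<Rightarrow> 'a"
  where "covariant_derivative S p u V =
    orth_proj (tangent_space S p) (frechet_derivative V (at p) u)"

definition normal_space :: "'a::euclidean_space set \<Rightarrow> 'a set \<Rightarrow> 'a \<Rightarrow> 'a set"
  where "normal_space S M p = tangent_space S p \<inter> (tangent_space M p)\<^sup>\<bottom>"

definition local_tangent_field :: "'a::euclidean_space set \<Rightarrow> 'a \<Rightarrow> ('a \<Rightarrow> 'a) \<Rightarrow> bool"
  where "local_tangent_field M p V \<longleftrightarrow>
    (\<exists>U. open U \<and> p \<in> U \<and> smooth_on U V \<and> (\<forall>x\<in>U \<inter> M. V x \<in> tangent_space M x))"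

text \<open>The second fundamental form at \<open>p\<close> of \<open>M\<close> as a submanifold of \<open>S\<close>, for tangent vectors
  \<open>u\<close>, \<open>v\<close>: the normal part of the covariant derivative along \<open>u\<close> of a tangent field extending
  \<open>v\<close>; it does not depend on the choice of that field.\<close>

definition second_fundamental_form ::
    "'a::euclidean_space set \<Rightarrow> 'a set \<Rightarrow> 'a \<Rightarrow> 'a \<Rightarrow> 'a \<Rightarrow> 'a"
  where "second_fundamental_form S M p u v =
    orth_proj (normal_space S M p)
      (covariant_derivative S p u (SOME V. local_tangent_field M p V \<and> V p = v))"

definition orthonormal_basis :: "'a::euclidean_space set \<Rightarrow> 'a set \<Rightarrow> bool"
  where "orthonormal_basis T B \<longleftrightarrow>
    B \<subseteq> T \<and> span B = T \<and> pairwise orthogonal B \<and> (\<forall>e\<in>B. norm e = 1)"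

definition mean_curvature :: "'a::euclidean_space set \<Rightarrow> 'a set \<Rightarrow> 'a \<Rightarrow> 'a"
  where "mean_curvature S M p =
    (\<Sum>e \<in> (SOME B. orthonormal_basis (tangent_space M p) B). second_fundamental_form S M p e e)
      /\<^sub>R real (dim (tangent_space M p))"

definition minimal_submanifold :: "'a::euclidean_space set \<Rightarrow> 'a set \<Rightarrow> bool"
  where "minimal_submanifold S M \<longleftrightarrow> (\<exists>k. submanifold k S) \<and> (\<exists>k. submanifold k M) \<and> M \<subseteq> S \<and>
    (\<forall>p\<in>M. mean_curvature S M p = 0)"

definition cone_over :: "'a::real_vector set \<Rightarrow> 'a set"
  where "cone_over M = {t *\<^sub>R x | t x. x \<in> M \<and> t \<ge> 0}"

definition opposite :: "'a::real_vector set \<Rightarrow> 'a set \<Rightarrow> bool"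
  where "opposite A B \<longleftrightarrow> B = uminus ` A"

end

theory Submission
  imports Defs
begin

text \<open>The geometry is that of Hermitian projectors written in block form.

  Write \<open>c = n/m\<close>.  Since \<open>P\<^sup>\<bottom> - (1 - c) I = - (P - c I)\<close>, complementation of projectors becomes
  the antipodal map after centring, which gives all statements about opposite images and cones.
  The equations \<open>P\<^sup>2 = P\<close> and \<open>tr P = n\<close> put \<open>P - c I\<close> in the traceless hyperplane at the distance
  \<open>r\<close> from the origin.  All the maps involved are homotheties followed by translations, so they
  are embeddings as soon as the Grassmannian and the sphere are known to be submanifolds.  For the
  sphere a stereographic projection is a chart.  Near \<open>P\<close> the projectors are those onto graphs of
  linear maps from the range of \<open>P\<close> to its complement: with \<open>Z\<close> Hermitian and \<open>P Z + Z P = Z\<close>, the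
  projector is \<open>(P + Z + Z P Z) (1 + Z\<^sup>2)\<^sup>-\<^sup>1\<close>, and \<open>Z\<close> is recovered from it rationally
  (\<open>graph_projector\<close>, \<open>projector_is_graph\<close>).  Only products and inverses of matrices occur, so
  that the three division algebras are treated alike.  In particular the tangent space at \<open>P\<close>
  consists of the Hermitian \<open>Z\<close> with \<open>P Z + Z P = Z\<close>, the off-diagonal blocks.

  For minimality, let \<open>V\<close> be a tangent field with value \<open>e\<close> at \<open>P\<close>.  Differentiating
  \<open>P V + V P = V\<close> in the direction \<open>e\<close> determines the block-diagonal part of the derivative: its inner
  product with a normal vector \<open>w\<close> is twice that of \<open>e\<^sup>2\<close> with \<open>(1 - 2 P) w\<close>
  (\<open>derivative_of_tangent_field\<close>, \<open>inner_derivative_normal\<close>).  Summing over an orthonormal basis of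
  the tangent space amounts to computing traces of operators \<open>X \<mapsto> A X C\<close> on the off-diagonal block,
  and these are products of traces (\<open>sum_tangent_basis\<close>).  The sum is therefore a combination of
  the traces of \<open>w P\<close> and \<open>w (1 - P)\<close>, which vanish because a vector tangent to the sphere is
  orthogonal to the identity and to \<open>P\<close>.\<close>

section \<open>Calculus of smooth maps\<close>

lemma ck_on_subset: "ck_on k U f \<Longrightarrow> V \<subseteq> U \<Longrightarrow> ck_on k V f"
proof (induction k arbitrary: f)
  case 0
  then show ?case by (auto intro: continuous_on_subset)
next
  case (Suc k)
  then show ?case by auto
qed

lemma ck_on_Suc_imp: "ck_on (Suc k) U f \<Longrightarrow> ck_on k U f"
proof (induction k arbitrary: f)
  case 0
  then show ?case
    by (auto intro!: continuous_at_imp_continuous_on differentiable_imp_continuous_within)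
next
  case (Suc k)
  then show ?case by (metis ck_on.simps(2))
qed

lemma frechet_derivative_cong_open:
  assumes "open U" "x \<in> U" "\<And>y. y \<in> U \<Longrightarrow> f y = g y"
  shows "frechet_derivative f (at x) = frechet_derivative g (at x)"
    and "f differentiable (at x) \<longleftrightarrow> g differentiable (at x)"
proof -
  have "(f has_derivative D) (at x) \<longleftrightarrow> (g has_derivative D) (at x)" for D
    using assms has_derivative_transform_within_open[of f D x UNIV U g]
      has_derivative_transform_within_open[of g D x UNIV U f] by auto
  then show "frechet_derivative f (at x) = frechet_derivative g (at x)"
    and "f differentiable (at x) \<longleftrightarrow> g differentiable (at x)"
    by (simp_all add: frechet_derivative_def differentiable_def)
qed

lemma ck_on_cong:
  "open U \<Longrightarrow> (\<And>y. y \<in> U \<Longrightarrow> f y = g y) \<Longrightarrow> ck_on k U f \<longleftrightarrow> ck_on k U g"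
proof (induction k arbitrary: f g)
  case 0
  then show ?case by (auto cong: continuous_on_cong)
next
  case (Suc k)
  have "ck_on k U (\<lambda>x. frechet_derivative f (at x) v) \<longleftrightarrow>
      ck_on k U (\<lambda>x. frechet_derivative g (at x) v)" for v
    using frechet_derivative_cong_open(1)[OF Suc.prems(1) _ Suc.prems(2)]
    by (intro Suc.IH[OF Suc.prems(1)]) simp
  then show ?case
    using frechet_derivative_cong_open(2)[OF Suc.prems(1) _ Suc.prems(2)] by simp
qed

text \<open>The form in which orders are raised throughout: any explicit formula for the derivative may
  replace the Frechet derivative, since the two agree on the open set.\<close>

lemma ck_on_SucI:
  assumes "open U" "\<And>x. x \<in> U \<Longrightarrow> (f has_derivative f' x) (at x)"
    and "\<And>v. ck_on k U (\<lambda>x. f' x v)"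
  shows "ck_on (Suc k) U f"
proof -
  have "frechet_derivative f (at x) = f' x" if "x \<in> U" for x
    using assms(2)[OF that] by (rule frechet_derivative_at[symmetric])
  then have "ck_on k U (\<lambda>x. frechet_derivative f (at x) v)" for v
    using ck_on_cong[OF assms(1), of "\<lambda>x. frechet_derivative f (at x) v" "\<lambda>x. f' x v"]
      assms(3) by simp
  then show ?thesis
    using assms(2) by (auto simp: differentiable_def)
qed

lemma ck_on_SucD:
  assumes "ck_on (Suc k) U f"
  shows "x \<in> U \<Longrightarrow> (f has_derivative frechet_derivative f (at x)) (at x)"
    and "ck_on k U (\<lambda>x. frechet_derivative f (at x) v)"
  using assms by (auto simp: frechet_derivative_works)

lemma ck_on_const: "open U \<Longrightarrow> ck_on k U (\<lambda>x. c)"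
proof (induction k arbitrary: c)
  case (Suc k)
  then show ?case by (intro ck_on_SucI[where f' = "\<lambda>x v. 0"]) auto
qed simp

lemma ck_on_ident:
  assumes "open U"
  shows "ck_on k U (\<lambda>x. x)"
proof (cases k)
  case (Suc l)
  show ?thesis
    unfolding Suc by (rule ck_on_SucI[OF assms has_derivative_ident ck_on_const[OF assms]])
qed simp

lemma ck_on_linear_comp:
  assumes "open U" "bounded_linear L"
  shows "ck_on k U f \<Longrightarrow> ck_on k U (\<lambda>x. L (f x))"
proof (induction k arbitrary: f)
  case 0
  then show ?case using assms by (simp add: bounded_linear.continuous_on)
next
  case (Suc k)
  then show ?case
    by (intro ck_on_SucI[OF assms(1), where f' = "\<lambda>x v. L (frechet_derivative f (at x) v)"])
      (auto intro!: bounded_linear.has_derivative[OF assms(2)] simp: frechet_derivative_works)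
qed

lemma ck_on_add:
  assumes "open U"
  shows "ck_on k U f \<Longrightarrow> ck_on k U g \<Longrightarrow> ck_on k U (\<lambda>x. f x + g x)"
proof (induction k arbitrary: f g)
  case 0
  then show ?case by (simp add: continuous_on_add)
next
  case (Suc k)
  then show ?case
    by (intro ck_on_SucI[OF assms(1),
          where f' = "\<lambda>x v. frechet_derivative f (at x) v + frechet_derivative g (at x) v"])
      (auto intro!: has_derivative_add simp: frechet_derivative_works)
qed

lemma ck_on_sum:
  assumes "open U" "\<And>i. i \<in> I \<Longrightarrow> ck_on k U (f i)"
  shows "ck_on k U (\<lambda>x. \<Sum>i\<in>I. f i x)"
  using assms(2)
  by (induction I rule: infinite_finite_induct) (auto intro: ck_on_const ck_on_add assms(1))

lemma ck_on_bilinear: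
  assumes "open U" "bounded_bilinear B"
  shows "ck_on k U f \<Longrightarrow> ck_on k U g \<Longrightarrow> ck_on k U (\<lambda>x. B (f x) (g x))"
proof (induction k arbitrary: f g)
  case 0
  then show ?case using assms by (simp add: bounded_bilinear.continuous_on)
next
  case (Suc k)
  have "ck_on k U f" "ck_on k U g"
    using Suc.prems by (auto intro: ck_on_Suc_imp)
  with Suc show ?case
    by (intro ck_on_SucI[OF assms(1), where f' = "\<lambda>x v. B (f x) (frechet_derivative g (at x) v) +
          B (frechet_derivative f (at x) v) (g x)"] bounded_bilinear.FDERIV[OF assms(2)] ck_on_add)
      (auto simp: frechet_derivative_works assms)
qed

text \<open>In finite dimension the chain rule reads \<open>D(f \<circ> g) v = (\<Sum>b. (Dg v \<bullet> b) (Df b) \<circ> g)\<close>, a sum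
  of products of maps of one order less, so that composition follows from the product rule.\<close>

lemma ck_on_compose:
  fixes g :: "'a::real_normed_vector \<Rightarrow> 'b::euclidean_space"
  assumes U: "open U" and V: "open V" and sub: "\<And>x. x \<in> V \<Longrightarrow> g x \<in> U"
  shows "ck_on k U f \<Longrightarrow> ck_on k V g \<Longrightarrow> ck_on k V (\<lambda>x. f (g x))"
proof (induction k arbitrary: f)
  case 0
  then show ?case
    using continuous_on_compose2[of U f V g] sub by (simp add: image_subset_iff)
next
  case (Suc k)
  let ?f = "\<lambda>x. frechet_derivative f (at x)" and ?g = "\<lambda>x. frechet_derivative g (at x)"
  have g: "ck_on k V g"
    by (rule ck_on_Suc_imp[OF Suc.prems(2)])
  have "ck_on k V (\<lambda>x. \<Sum>b\<in>Basis. (?g x v \<bullet> b) *\<^sub>R ?f (g x) b)" for v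
    by (intro ck_on_sum ck_on_bilinear[OF _ bounded_bilinear_scaleR] V
          ck_on_linear_comp[OF _ bounded_linear_inner_left] ck_on_SucD(2) Suc.prems
          Suc.IH[where f = "\<lambda>y. ?f y b" for b] g)
  moreover have "?f (g x) (?g x v) = (\<Sum>b\<in>Basis. (?g x v \<bullet> b) *\<^sub>R ?f (g x) b)" if "x \<in> V" for x v
  proof -
    interpret bounded_linear "?f (g x)"
      using ck_on_SucD(1)[OF Suc.prems(1) sub[OF that]] by (rule has_derivative_bounded_linear)
    have "?f (g x) (?g x v) = ?f (g x) (\<Sum>b\<in>Basis. (?g x v \<bullet> b) *\<^sub>R b)"
      by (simp add: euclidean_representation)
    then show ?thesis by (simp add: sum scaleR)
  qed
  ultimately have "ck_on k V (\<lambda>x. ?f (g x) (?g x v))" for v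
    by (subst ck_on_cong[OF V]) auto
  moreover have "((\<lambda>x. f (g x)) has_derivative (\<lambda>v. ?f (g x) (?g x v))) (at x)" if "x \<in> V" for x
    using diff_chain_at[OF ck_on_SucD(1)[OF Suc.prems(2) that]
        ck_on_SucD(1)[OF Suc.prems(1) sub[OF that]]] by (simp add: o_def)
  ultimately show ?case
    by (intro ck_on_SucI[OF V, where f' = "\<lambda>x v. ?f (g x) (?g x v)"])
qed

lemma smooth_on_subset: "smooth_on U f \<Longrightarrow> V \<subseteq> U \<Longrightarrow> smooth_on V f"
  by (auto simp: smooth_on_def intro: ck_on_subset)

lemma smooth_on_const: "open U \<Longrightarrow> smooth_on U (\<lambda>x. c)"
  by (simp add: smooth_on_def ck_on_const)

lemma smooth_on_ident: "open U \<Longrightarrow> smooth_on U (\<lambda>x. x)"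
  by (simp add: smooth_on_def ck_on_ident)

lemma smooth_on_linear:
  "open U \<Longrightarrow> bounded_linear L \<Longrightarrow> smooth_on U f \<Longrightarrow> smooth_on U (\<lambda>x. L (f x))"
  by (simp add: smooth_on_def ck_on_linear_comp)

lemma smooth_on_add:
  "open U \<Longrightarrow> smooth_on U f \<Longrightarrow> smooth_on U g \<Longrightarrow> smooth_on U (\<lambda>x. f x + g x)"
  by (simp add: smooth_on_def ck_on_add)

lemma smooth_on_diff:
  "open U \<Longrightarrow> smooth_on U f \<Longrightarrow> smooth_on U g \<Longrightarrow> smooth_on U (\<lambda>x. f x - g x)"
  using smooth_on_add[of U f "\<lambda>x. - g x"]
    smooth_on_linear[OF _ bounded_linear_minus[OF bounded_linear_ident], of U g] by simp

lemma smooth_on_bilinear: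
  "open U \<Longrightarrow> bounded_bilinear B \<Longrightarrow> smooth_on U f \<Longrightarrow> smooth_on U g \<Longrightarrow>
    smooth_on U (\<lambda>x. B (f x) (g x))"
  by (simp add: smooth_on_def ck_on_bilinear)

lemma smooth_on_compose:
  fixes g :: "'a::real_normed_vector \<Rightarrow> 'b::euclidean_space"
  shows "open U \<Longrightarrow> open V \<Longrightarrow> smooth_on U f \<Longrightarrow> smooth_on V g \<Longrightarrow> (\<And>x. x \<in> V \<Longrightarrow> g x \<in> U) \<Longrightarrow>
    smooth_on V (\<lambda>x. f (g x))"
  by (simp add: smooth_on_def ck_on_compose)

lemma smooth_on_imp_continuous_on: "smooth_on U f \<Longrightarrow> continuous_on U f"
  unfolding smooth_on_def using ck_on.simps(1) by blast

lemma smooth_on_has_derivative: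
  "smooth_on U f \<Longrightarrow> x \<in> U \<Longrightarrow> (f has_derivative frechet_derivative f (at x)) (at x)"
  unfolding smooth_on_def using ck_on_SucD(1) by blast

text \<open>The derivative of the inverse is a product of inverses, so the order can be raised by
  induction.\<close>

lemma smooth_on_inverse: "smooth_on {x :: real. x \<noteq> 0} inverse"
proof -
  have o: "open {x :: real. x \<noteq> 0}"
    by (rule open_Collect_neq) (auto intro: continuous_intros)
  have "ck_on k {x :: real. x \<noteq> 0} inverse" for k
  proof (induction k)
    case 0
    then show ?case by (auto intro!: continuous_intros)
  next
    case (Suc k)
    have "ck_on k {x. x \<noteq> 0} (\<lambda>x. - (inverse x * v * inverse x))" for v :: real
      by (intro ck_on_linear_comp[OF o bounded_linear_minus[OF bounded_linear_ident]]
          ck_on_bilinear[OF o bounded_bilinear_mult] Suc ck_on_const[OF o])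
    then show ?case
      by (intro ck_on_SucI[OF o, where f' = "\<lambda>x v. - (inverse x * v * inverse x)"])
        (auto intro!: has_derivative_inverse' )
  qed
  then show ?thesis by (simp add: smooth_on_def)
qed

section \<open>Diffeomorphisms and submanifolds\<close>

lemma smooth_map_of_smooth_on: "open U \<Longrightarrow> M \<subseteq> U \<Longrightarrow> smooth_on U f \<Longrightarrow> smooth_map M f"
  unfolding smooth_map_def by blast

lemma smooth_map_cong: "(\<And>x. x \<in> M \<Longrightarrow> f x = g x) \<Longrightarrow> smooth_map M f \<longleftrightarrow> smooth_map M g"
  unfolding smooth_map_def by simp

lemma smooth_map_compose:
  fixes f :: "'a::real_normed_vector \<Rightarrow> 'b::euclidean_space"
  assumes f: "smooth_map M f" and g: "smooth_map N g" and sub: "f ` M \<subseteq> N"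
  shows "smooth_map M (\<lambda>x. g (f x))"
  unfolding smooth_map_def
proof
  fix x assume x: "x \<in> M"
  obtain U F where U: "open U" "x \<in> U" "smooth_on U F" "\<forall>y\<in>U \<inter> M. F y = f y"
    using f x unfolding smooth_map_def by blast
  have "f x \<in> N" using sub x by blast
  then obtain W G where W: "open W" "f x \<in> W" "smooth_on W G" "\<forall>y\<in>W \<inter> N. G y = g y"
    using g unfolding smooth_map_def by blast
  have o: "open (U \<inter> F -` W)"
    by (rule continuous_open_preimage[OF smooth_on_imp_continuous_on[OF U(3)] U(1) W(1)])
  have "smooth_on (U \<inter> F -` W) (\<lambda>y. G (F y))"
    by (rule smooth_on_compose[OF W(1) o W(3) smooth_on_subset[OF U(3)]]) auto
  moreover have "\<forall>y\<in>(U \<inter> F -` W) \<inter> M. G (F y) = g (f y)"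
    using U(4) W(4) sub by (auto simp: image_subset_iff)
  ultimately show "\<exists>U h. open U \<and> x \<in> U \<and> smooth_on U h \<and> (\<forall>y\<in>U \<inter> M. h y = g (f y))"
    using o U W x by (intro exI[of _ "U \<inter> F -` W"] exI[of _ "\<lambda>y. G (F y)"]) auto
qed

lemma diffeoI:
  assumes "smooth_map M f" "smooth_map M' g" "f ` M \<subseteq> M'" "g ` M' \<subseteq> M"
    and "\<And>x. x \<in> M \<Longrightarrow> g (f x) = x" "\<And>y. y \<in> M' \<Longrightarrow> f (g y) = y"
  shows "diffeo M M' f"
proof -
  have b: "bij_betw f M M'"
    using assms(3-6) by (intro bij_betwI[where g = g]) auto
  have "inv_into M f y = g y" if "y \<in> M'" for y
    using assms(4,6) that b by (metis bij_betw_def image_subset_iff inv_into_f_f)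
  then have "smooth_map M' (inv_into M f)"
    using assms(2) smooth_map_cong[of M' "inv_into M f" g] by simp
  with b assms(1) show ?thesis by (simp add: diffeo_def)
qed

lemma diffeo_compose:
  fixes f :: "'a::euclidean_space \<Rightarrow> 'b::euclidean_space"
  assumes f: "diffeo A B f" and g: "diffeo B C g"
  shows "diffeo A C (\<lambda>x. g (f x))"
proof -
  have bf: "bij_betw f A B" and bg: "bij_betw g B C"
    using f g by (auto simp: diffeo_def)
  show ?thesis
  proof (rule diffeoI[where g = "\<lambda>z. inv_into A f (inv_into B g z)"])
    show "smooth_map A (\<lambda>x. g (f x))"
      by (rule smooth_map_compose[where N = B])
        (use f g bij_betw_imp_surj_on[OF bf] in \<open>simp_all add: diffeo_def\<close>)
    show "smooth_map C (\<lambda>z. inv_into A f (inv_into B g z))"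
      by (rule smooth_map_compose[where N = B])
        (use f g bij_betw_imp_surj_on[OF bij_betw_inv_into[OF bg]] in \<open>simp_all add: diffeo_def\<close>)
    show "(\<lambda>x. g (f x)) ` A \<subseteq> C"
      using bij_betw_apply[OF bf] bij_betw_apply[OF bg] by auto
    show "(\<lambda>z. inv_into A f (inv_into B g z)) ` C \<subseteq> A"
      using bij_betw_apply[OF bij_betw_inv_into[OF bf]] bij_betw_apply[OF bij_betw_inv_into[OF bg]]
      by auto
    show "inv_into A f (inv_into B g (g (f x))) = x" if "x \<in> A" for x
      using that bij_betw_apply[OF bf that] bij_betw_inv_into_left[OF bf]
        bij_betw_inv_into_left[OF bg] by simp
    show "g (f (inv_into A f (inv_into B g z))) = z" if "z \<in> C" for z
      using that bij_betw_apply[OF bij_betw_inv_into[OF bg] that] bij_betw_inv_into_right[OF bf]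
        bij_betw_inv_into_right[OF bg] by simp
  qed
qed

text \<open>Nonzero homotheties and translations cover both the embeddings of the theorem (translations)
  and the antipodal map.\<close>

lemma smooth_on_affinity:
  fixes a :: "'a::euclidean_space"
  shows "smooth_on UNIV (\<lambda>x. a + c *\<^sub>R x)"
  by (intro smooth_on_add smooth_on_const smooth_on_linear[OF _ bounded_linear_scaleR_right]
      smooth_on_ident) auto

lemma diffeo_affinity:
  fixes a :: "'a::euclidean_space"
  assumes "c \<noteq> 0"
  shows "diffeo M ((\<lambda>x. a + c *\<^sub>R x) ` M) (\<lambda>x. a + c *\<^sub>R x)"
proof (rule diffeoI[where g = "\<lambda>y. (- inverse c *\<^sub>R a) + inverse c *\<^sub>R y"])
  show "smooth_map M (\<lambda>x. a + c *\<^sub>R x)"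
    "smooth_map ((\<lambda>x. a + c *\<^sub>R x) ` M) (\<lambda>y. (- inverse c *\<^sub>R a) + inverse c *\<^sub>R y)"
    by (rule smooth_map_of_smooth_on[OF open_UNIV subset_UNIV smooth_on_affinity])+
qed (use assms in \<open>auto simp: algebra_simps\<close>)

lemma submanifold_affinity:
  fixes a :: "'a::euclidean_space"
  assumes M: "submanifold k M" and c: "c \<noteq> 0"
  shows "submanifold k ((\<lambda>x. a + c *\<^sub>R x) ` M)"
  unfolding submanifold_def
proof
  let ?h = "\<lambda>x. a + c *\<^sub>R x"
  fix q assume "q \<in> ?h ` M"
  then obtain p where p: "p \<in> M" "q = ?h p" by blast
  obtain U V and T :: "'a set" and f where ch: "open U" "p \<in> U" "open V" "subspace T" "dim T = k"
    "diffeo (V \<inter> T) (U \<inter> M) f"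
    using bspec[OF M[unfolded submanifold_def] p(1)] by (elim exE conjE) (rule that)
  have inj: "inj ?h" using c by (auto intro: injI)
  have "diffeo (V \<inter> T) (?h ` (U \<inter> M)) (\<lambda>x. ?h (f x))"
    by (rule diffeo_compose[OF ch(6) diffeo_affinity[OF c]])
  then have "diffeo (V \<inter> T) (?h ` U \<inter> ?h ` M) (\<lambda>x. ?h (f x))"
    by (simp only: image_Int[OF inj])
  moreover have "open (?h ` U)"
    by (rule open_affinity[OF ch(1) c])
  ultimately show "\<exists>U V (T :: 'a set) f. open U \<and> q \<in> U \<and> open V \<and> subspace T \<and> dim T = k \<and>
      diffeo (V \<inter> T) (U \<inter> ?h ` M) f"
    using ch p by blast
qed

text \<open>A chart may be given by two smooth maps on open sets that invert each other only between \<open>T\<close>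
  and \<open>M\<close>, without any control of the image of the open sets: each domain can be cut down to the
  points that the map sends into the domain of the other.\<close>

lemma submanifold_chartI:
  fixes f g :: "'a::euclidean_space \<Rightarrow> 'a"
  assumes V: "open V" "smooth_on V f" and U: "open U" "smooth_on U g"
    and f: "\<And>z. z \<in> V \<inter> T \<Longrightarrow> f z \<in> M" and g: "\<And>x. x \<in> U \<inter> M \<Longrightarrow> g x \<in> T"
    and gf: "\<And>z. z \<in> V \<inter> T \<Longrightarrow> f z \<in> U \<Longrightarrow> g (f z) = z"
    and fg: "\<And>x. x \<in> U \<inter> M \<Longrightarrow> g x \<in> V \<Longrightarrow> f (g x) = x"
    and p: "p \<in> U" "g p \<in> V"
  shows "\<exists>U V. open U \<and> p \<in> U \<and> open V \<and> diffeo (V \<inter> T) (U \<inter> M) f"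
proof -
  have o: "open (U \<inter> g -` V)" "open (V \<inter> f -` U)"
    using U V by (auto intro!: continuous_open_preimage smooth_on_imp_continuous_on)
  have "diffeo (V \<inter> f -` U \<inter> T) (U \<inter> g -` V \<inter> M) f"
    using f g gf fg
    by (intro diffeoI[where g = g] smooth_map_of_smooth_on[OF V(1) _ V(2)]
        smooth_map_of_smooth_on[OF U(1) _ U(2)]) auto
  with o p show ?thesis by blast
qed

text \<open>Lines through the origin of the parameter space are carried to curves in \<open>M\<close>.\<close>

lemma tangent_spaceI:
  fixes f :: "'a::euclidean_space \<Rightarrow> 'a"
  assumes V: "open V" "smooth_on V f" "0 \<in> V" and T: "subspace T" "v \<in> T"
    and f: "\<And>z. z \<in> V \<inter> T \<Longrightarrow> f z \<in> M"
    and D: "(f has_derivative D) (at 0)"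
  shows "D v \<in> tangent_space M (f 0)"
proof -
  have c: "continuous_on UNIV (\<lambda>t. t *\<^sub>R v)" by (intro continuous_intros)
  have "open ((\<lambda>t. t *\<^sub>R v) -` V)"
    by (rule open_vimage[OF V(1) c])
  then obtain e where e: "e > 0" "ball 0 e \<subseteq> (\<lambda>t. t *\<^sub>R v) -` V"
    using V(3) openE[of "(\<lambda>t. t *\<^sub>R v) -` V" 0] by auto
  have i: "{-e<..<e} \<subseteq> (\<lambda>t. t *\<^sub>R v) -` V"
  proof
    fix t assume "t \<in> {-e<..<e}"
    then have "t \<in> ball 0 e" by auto
    then show "t \<in> (\<lambda>t. t *\<^sub>R v) -` V" using e(2) by blast
  qed
  have s: "smooth_on {-e<..<e} (\<lambda>t. f (t *\<^sub>R v))"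
    by (rule smooth_on_compose[OF V(1) _ V(2)
          smooth_on_linear[OF _ bounded_linear_scaleR_left smooth_on_ident]]) (use i in auto)
  have l: "((\<lambda>t. t *\<^sub>R v) has_derivative (\<lambda>t. t *\<^sub>R v)) (at 0)"
    by (rule bounded_linear.has_derivative[OF bounded_linear_scaleR_left has_derivative_ident])
  have "((\<lambda>t. f (t *\<^sub>R v)) has_derivative (\<lambda>t. D (t *\<^sub>R v))) (at 0)"
    using diff_chain_at[OF l, of f D] D by (simp add: o_def)
  moreover have "D (t *\<^sub>R v) = t *\<^sub>R D v" for t
    using linear_scale[OF has_derivative_linear[OF D]] by simp
  ultimately have "((\<lambda>t. f (t *\<^sub>R v)) has_vector_derivative D v) (at 0)"
    by (simp add: has_vector_derivative_def)
  moreover have "(\<lambda>t. f (t *\<^sub>R v)) ` {-e<..<e} \<subseteq> M"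
    using i f T by (auto simp: subspace_scale)
  ultimately show ?thesis
    unfolding tangent_space_def using e(1) s
    by (intro CollectI exI[of _ e] exI[of _ "\<lambda>t. f (t *\<^sub>R v)"]) auto
qed

section \<open>Matrices over a real division algebra with conjugation\<close>

text \<open>These identities hold for quaternions componentwise and are pulled back along the embedding
  into them. The last one makes conjugation accessible through the inner product alone.\<close>

lemma fcnj_mult: "fcnj (x * y :: 'f::rch) = fcnj y * fcnj x"
  and fcnj_fcnj [simp]: "fcnj (fcnj x :: 'f) = x"
  and fcnj_eq: "fcnj (x :: 'f) = (2 * inner x 1) *\<^sub>R 1 - x"
proof -
  obtain \<phi> :: "'f \<Rightarrow> quat" where a: "\<And>x y. \<phi> (x + y) = \<phi> x + \<phi> y"
    and s: "\<And>r x. \<phi> (r *\<^sub>R x) = r *\<^sub>R \<phi> x"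
    and m: "\<And>x y. \<phi> (x * y) = \<phi> x * \<phi> y" and n: "\<And>x. norm (\<phi> x) = norm x"
    and c: "\<And>x. \<phi> (fcnj x) = qcnj (\<phi> x)" and r: "\<And>x. fRe x = qRe (\<phi> x)"
    using rch_embedding[where 'a='f] by (elim exE conjE) (rule that; simp)
  have d: "\<phi> (x - y) = \<phi> x - \<phi> y" for x y
    using a[of "x - y" y] by simp
  have inj: "x = y" if "\<phi> x = \<phi> y" for x y
    using n[of "x - y"] that by (simp add: d)
  have one: "\<phi> 1 = 1"
  proof -
    have "\<phi> 1 \<noteq> 0" using n[of 1] by auto
    then show ?thesis using m[of 1 1] by simp
  qed
  show "fcnj (x * y) = fcnj y * fcnj x"
    by (rule inj) (simp add: c m quat_eq_iff quat_times_sel algebra_simps)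
  show "fcnj (fcnj x) = x"
    by (rule inj) (simp add: c quat_eq_iff)
  have "fRe x = inner x 1"
    using fRe_mult_fcnj[of x 1] by (simp add: fcnj_one)
  then show "fcnj x = (2 * inner x 1) *\<^sub>R 1 - x"
    by (intro inj) (simp add: c d s one quat_eq_iff r)
qed

lemma inner_mult_fcnj_left: "inner (x * y) z = inner y (fcnj x * z)"
  and inner_mult_fcnj_right: "inner (x * y) z = inner x (z * fcnj y)" for x y z :: "'f::rch"
proof -
  have "inner (x * y) z = fRe (x * (y * fcnj z))"
    by (simp add: fRe_mult_fcnj[symmetric] mult.assoc)
  also have "\<dots> = fRe (y * fcnj z * x)"
    by (rule fRe_mult_commute)
  finally have *: "inner (x * y) z = fRe (y * fcnj z * x)" .
  show "inner (x * y) z = inner y (fcnj x * z)"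
    unfolding * by (simp add: fRe_mult_fcnj[symmetric] fcnj_mult mult.assoc)
  show "inner (x * y) z = inner x (z * fcnj y)"
    by (simp add: fRe_mult_fcnj[symmetric] fcnj_mult mult.assoc)
qed

lemma selfconjugate_real: "fcnj (x :: 'f::rch) = x \<Longrightarrow> x = inner x 1 *\<^sub>R 1"
proof -
  assume "fcnj x = x"
  then have "2 *\<^sub>R x = 2 *\<^sub>R (inner x 1 *\<^sub>R 1)"
    using fcnj_eq[of x] by (simp add: scaleR_2 algebra_simps)
  then show ?thesis by (simp only: scaleR_cancel_left) simp
qed

lemma ctranspose_simps:
  fixes A B :: "'f::rch^'m^'m"
  shows "ctranspose (A + B) = ctranspose A + ctranspose B"
    "ctranspose (A - B) = ctranspose A - ctranspose B"
    "ctranspose (r *\<^sub>R A) = r *\<^sub>R ctranspose A"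
    "ctranspose (A ** B) = ctranspose B ** ctranspose A"
    "ctranspose (ctranspose A) = A"
    "ctranspose (mat 1 :: 'f^'m^'m) = mat 1"
proof -
  have m: "fcnj (- x) = - fcnj x" for x :: 'f
    using fcnj_scaleR[of "-1" x] by simp
  have d: "fcnj (x - y) = fcnj x - fcnj y" for x y :: 'f
    using fcnj_add[of x "- y"] m by simp
  have "fcnj (sum f S) = (\<Sum>i\<in>S. fcnj (f i))" for f :: "'m \<Rightarrow> 'f" and S
    using fcnj_scaleR[of 0 "0 :: 'f"]
    by (induction S rule: infinite_finite_induct) (auto simp: fcnj_add)
  then show "ctranspose (A ** B) = ctranspose B ** ctranspose A"
    by (simp add: ctranspose_def matrix_matrix_mult_def vec_eq_iff fcnj_mult)
  show "ctranspose (A - B) = ctranspose A - ctranspose B"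
    by (simp add: ctranspose_def vec_eq_iff d)
qed (simp_all add: ctranspose_mat_1, simp_all add: ctranspose_def vec_eq_iff fcnj_add fcnj_scaleR)

lemma inner_matmul_left:
  fixes A B C :: "'f::rch^'m^'m"
  shows "inner (A ** B) C = inner B (ctranspose A ** C)"
proof -
  have "inner (A ** B) C = (\<Sum>i\<in>UNIV. \<Sum>j\<in>UNIV. \<Sum>k\<in>UNIV. inner (B $ k $ j) (fcnj (A $ i $ k) * C $ i $ j))"
    by (simp add: inner_vec_def matrix_matrix_mult_def inner_sum_left inner_mult_fcnj_left)
  also have "\<dots> = (\<Sum>j\<in>UNIV. \<Sum>i\<in>UNIV. \<Sum>k\<in>UNIV. inner (B $ k $ j) (fcnj (A $ i $ k) * C $ i $ j))"
    by (rule sum.swap)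
  also have "\<dots> = (\<Sum>j\<in>UNIV. \<Sum>k\<in>UNIV. \<Sum>i\<in>UNIV. inner (B $ k $ j) (fcnj (A $ i $ k) * C $ i $ j))"
    by (rule sum.cong[OF refl sum.swap])
  also have "\<dots> = (\<Sum>k\<in>UNIV. \<Sum>j\<in>UNIV. \<Sum>i\<in>UNIV. inner (B $ k $ j) (fcnj (A $ i $ k) * C $ i $ j))"
    by (rule sum.swap)
  also have "\<dots> = inner B (ctranspose A ** C)"
    by (simp add: inner_vec_def matrix_matrix_mult_def inner_sum_right ctranspose_def)
  finally show ?thesis .
qed

lemma inner_ctranspose: "inner (ctranspose A) (ctranspose B) = inner A B"
  for A B :: "'f::rch^'m^'m"
proof -
  have c: "inner (fcnj x) (fcnj y) = inner x y" for x y :: 'f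
    using inner_mult_fcnj_left[of "fcnj x" 1 "fcnj y"] inner_mult_fcnj_right[of 1 x "y"]
    by (metis fRe_mult_commute fRe_mult_fcnj fcnj_fcnj inner_commute)
  have "inner (ctranspose A) (ctranspose B) = (\<Sum>i\<in>UNIV. \<Sum>j\<in>UNIV. inner (A $ j $ i) (B $ j $ i))"
    by (simp add: inner_vec_def ctranspose_def c)
  also have "\<dots> = inner A B"
    unfolding inner_vec_def by (rule sum.swap)
  finally show ?thesis .
qed

lemma inner_matmul_right:
  fixes A B C :: "'f::rch^'m^'m"
  shows "inner (A ** B) C = inner A (C ** ctranspose B)"
  using inner_ctranspose[of "A ** B" C] inner_ctranspose[of A "C ** ctranspose B"]
  by (simp add: ctranspose_simps inner_matmul_left)

text \<open>The real part of the trace of \<open>A\<close> is \<open>inner A (mat 1)\<close>. It is invariant under cyclic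
  permutations of a product, whereas the trace itself is not when the scalars are quaternions.\<close>

lemma real_trace_cyclic: "inner (A ** B) (mat 1) = inner (B ** A) (mat 1)"
  for A B :: "'f::rch^'m^'m"
  by (simp add: inner_matmul_left[of A] inner_matmul_right[of B])

lemma trace_hermitian:
  fixes A :: "'f::rch^'m^'m"
  assumes "ctranspose A = A"
  shows "trace A = inner A (mat 1) *\<^sub>R 1"
proof -
  have "A $ i $ i = inner (A $ i $ i) 1 *\<^sub>R 1" for i
    using arg_cong[OF assms, of "\<lambda>M. M $ i $ i"] by (intro selfconjugate_real) (simp add: ctranspose_def)
  then have "trace A = (\<Sum>i\<in>UNIV. inner (A $ i $ i) 1) *\<^sub>R 1"
    unfolding trace_def scaleR_sum_left by (intro sum.cong) auto
  also have "(\<Sum>i\<in>UNIV. inner (A $ i $ i) 1) = inner A (mat 1)"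
    by (simp add: inner_vec_def mat_def if_distrib cong: if_cong)
  finally show ?thesis .
qed

lemma bounded_bilinear_matmul:
  "bounded_bilinear ((**) :: 'f::rch^'m^'m \<Rightarrow> 'f^'m^'m \<Rightarrow> 'f^'m^'m)"
proof -
  have "bilinear ((**) :: 'f^'m^'m \<Rightarrow> 'f^'m^'m \<Rightarrow> 'f^'m^'m)"
    unfolding bilinear_def
    by (intro conjI allI linearI)
      (simp_all add: matrix_matrix_mult_def vec_eq_iff algebra_simps sum.distrib scaleR_sum_right)
  then show ?thesis by (simp add: bilinear_conv_bounded_bilinear)
qed

interpretation matmul: bounded_bilinear "(**) :: 'f::rch^'m^'m \<Rightarrow> 'f^'m^'m \<Rightarrow> 'f^'m^'m"
  by (rule bounded_bilinear_matmul)

lemmas matalg = matrix_mul_assoc[symmetric] matmul.add_left matmul.add_right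
  matmul.diff_left matmul.diff_right matmul.minus_left matmul.minus_right
  matmul.scaleR_left matmul.scaleR_right

lemma left_right_inverse_eq:
  fixes A B C :: "'f::rch^'m^'m"
  assumes "C ** A = mat 1" "A ** B = mat 1"
  shows "C = B"
proof -
  have "C = C ** (A ** B)" by (simp add: assms)
  also have "\<dots> = B" by (simp add: matrix_mul_assoc assms(1))
  finally show ?thesis .
qed

lemma matrix_inv_eqI:
  fixes A B :: "'f::rch^'m^'m"
  assumes "A ** B = mat 1" "B ** A = mat 1"
  shows "matrix_inv A = B"
  unfolding matrix_inv_def
proof (rule some_equality)
  fix C assume "A ** C = mat 1 \<and> C ** A = mat 1"
  then show "C = B"
    by (intro left_right_inverse_eq[OF _ assms(1)]) simp
qed (use assms in simp)

lemma matrix_inv_works: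
  fixes A B :: "'f::rch^'m^'m"
  assumes "A ** B = mat 1" "B ** A = mat 1"
  shows "A ** matrix_inv A = mat 1" "matrix_inv A ** A = mat 1"
  using matrix_inv_eqI[OF assms] assms by simp_all

lemma inverse_commute:
  fixes A B C :: "'f::rch^'m^'m"
  assumes "A ** B = mat 1" "B ** A = mat 1" "A ** C = C ** A"
  shows "B ** C = C ** B"
proof -
  have "B ** C = B ** (C ** A) ** B"
    by (simp add: matalg assms)
  also have "\<dots> = (B ** A) ** C ** B"
    by (simp only: assms(3)[symmetric] matrix_mul_assoc)
  also have "\<dots> = C ** B"
    by (simp add: assms(2))
  finally show ?thesis .
qed

lemma ctranspose_inverse:
  fixes A B :: "'f::rch^'m^'m"
  assumes "A ** B = mat 1" "B ** A = mat 1" "ctranspose A = A"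
  shows "ctranspose B = B"
proof -
  have "ctranspose B ** A = mat 1" "A ** ctranspose B = mat 1"
    using arg_cong[OF assms(1), of ctranspose] arg_cong[OF assms(2), of ctranspose] assms(3)
    by (simp_all add: ctranspose_simps)
  then show ?thesis
    using matrix_inv_eqI[of A B] matrix_inv_eqI[of A "ctranspose B"] assms by simp
qed

text \<open>Near the identity, left and right multiplication by \<open>A\<close> are injective linear endomorphisms
  of a space of finite dimension, hence surjective; this yields a two-sided inverse without
  determinants, which make no sense over the quaternions.\<close>

lemma matrix_inv_near_id:
  obtains \<delta> K where "\<delta> > 0"
    "\<And>A :: 'f::rch^'m^'m. A \<in> ball (mat 1) \<delta> \<Longrightarrow>
       A ** matrix_inv A = mat 1 \<and> matrix_inv A ** A = mat 1 \<and> norm (matrix_inv A) \<le> K"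
proof -
  obtain K where K: "K > 0" "\<And>(A :: 'f^'m^'m) (B :: 'f^'m^'m). norm (A ** B) \<le> norm A * norm B * K"
    using bounded_bilinear.pos_bounded[OF bounded_bilinear_matmul[where 'f='f and 'm='m]] by auto
  \<comment> \<open>This radius makes multiplication by \<open>A - 1\<close> a contraction by the factor 1/2.\<close>
  define \<delta> where "\<delta> = 1 / (2 * K)"
  have \<delta>: "\<delta> > 0" "K * \<delta> = 1/2" using K by (simp_all add: \<delta>_def)
  have small: "norm ((A - mat 1) ** B) \<le> norm B / 2" "norm (B ** (A - mat 1)) \<le> norm B / 2"
    if "A \<in> ball (mat 1) \<delta>" for A B :: "'f^'m^'m"
  proof -
    have "norm (A - mat 1) * (norm B * K) \<le> \<delta> * (norm B * K)"
      using that K by (intro mult_right_mono) (auto simp: dist_norm norm_minus_commute)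
    moreover have "\<delta> * (norm B * K) = norm B / 2"
      using \<delta>(2) by (metis mult.assoc mult.commute mult_1 times_divide_eq_right mult.right_neutral)
    ultimately show "norm ((A - mat 1) ** B) \<le> norm B / 2" "norm (B ** (A - mat 1)) \<le> norm B / 2"
      using K(2)[of "A - mat 1" B] K(2)[of B "A - mat 1"]
      by (simp_all only: mult.assoc mult.left_commute[of "norm B"])
  qed
  have ex: "\<exists>B. A ** B = mat 1 \<and> B ** A = mat 1" if A: "A \<in> ball (mat 1) \<delta>" for A :: "'f^'m^'m"
  proof -
    have l: "linear (\<lambda>X :: 'f^'m^'m. A ** X)" "linear (\<lambda>X :: 'f^'m^'m. X ** A)"
      by (rule bounded_linear.linear, rule matmul.bounded_linear_right)
        (rule bounded_linear.linear, rule matmul.bounded_linear_left)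
    have z: "X = 0" if "A ** X = 0 \<or> X ** A = 0" for X :: "'f^'m^'m"
    proof -
      have "norm X \<le> norm X / 2"
        using that small[OF A, of X] by (auto simp: matalg)
      then show ?thesis by simp
    qed
    have inj: "inj (\<lambda>X :: 'f^'m^'m. A ** X)" "inj (\<lambda>X :: 'f^'m^'m. X ** A)"
      unfolding linear_injective_0[OF l(1)] linear_injective_0[OF l(2)] using z by blast+
    have "surj (\<lambda>X :: 'f^'m^'m. A ** X)" "surj (\<lambda>X :: 'f^'m^'m. X ** A)"
      by (rule linear_inj_imp_surj[OF l(1) inj(1)],
          rule linear_inj_imp_surj[OF l(2) inj(2)])
    then obtain B C :: "'f^'m^'m" where "A ** B = mat 1" "C ** A = mat 1"
      unfolding surj_def by metis
    moreover from this have "C = B"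
      using left_right_inverse_eq[of C A B] by simp
    ultimately show ?thesis by blast
  qed
  show thesis
  proof (rule that[OF \<delta>(1)])
    fix A :: "'f^'m^'m" assume A: "A \<in> ball (mat 1) \<delta>"
    have *: "A ** matrix_inv A = mat 1" "matrix_inv A ** A = mat 1"
      using ex[OF A] matrix_inv_works by blast+
    have "matrix_inv A = mat 1 - (A - mat 1) ** matrix_inv A"
      using * by (simp add: matalg)
    then have "norm (matrix_inv A) \<le> norm (mat 1 :: 'f^'m^'m) + norm (matrix_inv A) / 2"
      using small(1)[OF A, of "matrix_inv A"] norm_triangle_ineq4[of "mat 1" "(A - mat 1) ** matrix_inv A"]
      by simp
    then show "A ** matrix_inv A = mat 1 \<and> matrix_inv A ** A = mat 1 \<and>
        norm (matrix_inv A) \<le> 2 * norm (mat 1 :: 'f^'m^'m)"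
      using * by simp
  qed
qed

text \<open>The derivative \<open>- A\<^sup>-\<^sup>1 v A\<^sup>-\<^sup>1\<close> of the inverse is a product of inverses, so smoothness
  follows by induction on the order once the inverse is known to be differentiable; that in turn
  follows from the resolvent identity \<open>Y\<^sup>-\<^sup>1 - A\<^sup>-\<^sup>1 = - Y\<^sup>-\<^sup>1 (Y - A) A\<^sup>-\<^sup>1\<close> and the local bound.\<close>

lemma smooth_on_matrix_inv:
  obtains \<delta> where "\<delta> > 0" "smooth_on (ball (mat 1) \<delta>) (matrix_inv :: 'f::rch^'m^'m \<Rightarrow> 'f^'m^'m)"
    "\<And>A :: 'f^'m^'m. A \<in> ball (mat 1) \<delta> \<Longrightarrow>
       A ** matrix_inv A = mat 1 \<and> matrix_inv A ** A = mat 1"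
proof -
  obtain \<delta> K where \<delta>: "\<delta> > 0" and inv: "\<And>A :: 'f^'m^'m. A \<in> ball (mat 1) \<delta> \<Longrightarrow>
      A ** matrix_inv A = mat 1 \<and> matrix_inv A ** A = mat 1 \<and> norm (matrix_inv A) \<le> K"
    using matrix_inv_near_id[where 'f='f and 'm='m] by metis
  have "norm (matrix_inv (mat 1 :: 'f^'m^'m)) \<le> K"
    using conjunct2[OF conjunct2[OF inv[of "mat 1"]]] \<delta> by simp
  then have K0: "K \<ge> 0" by (rule order_trans[OF norm_ge_zero])
  obtain C where C: "C > 0" "\<And>(A :: 'f^'m^'m) (B :: 'f^'m^'m). norm (A ** B) \<le> norm A * norm B * C"
    using bounded_bilinear.pos_bounded[OF bounded_bilinear_matmul[where 'f='f and 'm='m]] by auto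
  have D: "(matrix_inv has_derivative (\<lambda>V. - (matrix_inv A ** V ** matrix_inv A))) (at A)"
    if A: "A \<in> ball (mat 1) \<delta>" for A :: "'f^'m^'m"
  proof -
    obtain e where e: "e > 0" "ball A e \<subseteq> ball (mat 1) \<delta>"
      using A openE[OF open_ball] by blast
    show ?thesis
    proof (rule has_derivativeI_sandwich[OF e(1),
          where H = "\<lambda>Y. K * K * K * C * C * C * C * norm (Y - A)"])
      show "bounded_linear (\<lambda>V. - (matrix_inv A ** V ** matrix_inv A))"
        by (intro bounded_linear_minus
            bounded_linear_compose[OF matmul.bounded_linear_left matmul.bounded_linear_right])
      show "((\<lambda>Y. K * K * K * C * C * C * C * norm (Y - A)) \<longlongrightarrow> 0) (at A)"
        by (auto intro!: tendsto_eq_intros)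
    next
      fix Y assume Y: "Y \<noteq> A" "dist Y A < e"
      define a where "a = matrix_inv A"
      define y where "y = matrix_inv Y"
      have "Y \<in> ball (mat 1) \<delta>"
        using Y e by (auto simp: subset_iff dist_commute)
      then have y: "Y ** y = mat 1" "y ** Y = mat 1" "norm y \<le> K"
        using inv by (auto simp: y_def)
      have a: "A ** a = mat 1" "a ** A = mat 1" "norm a \<le> K"
        using inv[OF A] by (auto simp: a_def)
      have y': "y ** (Y ** X) = X" and a': "A ** (a ** X) = X" for X
        using y a by (simp_all add: matrix_mul_assoc)
      have eq: "y - a + a ** (Y - A) ** a = y ** ((Y - A) ** (a ** ((Y - A) ** a)))"
        using a y by (simp add: matalg y' a')
      have n2: "norm (a ** ((Y - A) ** a)) \<le> K * (norm (Y - A) * K * C) * C"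
        using C(1) a(3) K0
        by (intro order_trans[OF C(2)] mult_right_mono mult_mono order_trans[OF C(2)]) auto
      have n3: "norm ((Y - A) ** (a ** ((Y - A) ** a)))
          \<le> norm (Y - A) * (K * (norm (Y - A) * K * C) * C) * C"
        using C(1) K0 by (intro order_trans[OF C(2)] mult_right_mono mult_left_mono n2) auto
      have "norm (y ** ((Y - A) ** (a ** ((Y - A) ** a))))
          \<le> K * (norm (Y - A) * (K * (norm (Y - A) * K * C) * C) * C) * C"
        using C(1) K0 y(3) a(3) n3 by (intro order_trans[OF C(2)] mult_right_mono mult_mono) auto
      also have "\<dots> = K * K * K * C * C * C * C * norm (Y - A) * norm (Y - A)"
        by simp
      finally have "norm (y - a + a ** (Y - A) ** a) \<le> K * K * K * C * C * C * C * norm (Y - A) * norm (Y - A)"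
        by (simp only: eq)
      then show "norm (matrix_inv Y - matrix_inv A - - (matrix_inv A ** (Y - A) ** matrix_inv A)) / norm (Y - A)
          \<le> K * K * K * C * C * C * C * norm (Y - A)"
        using Y(1) by (simp add: a_def y_def divide_le_eq)
    qed
  qed
  have "ck_on k (ball (mat 1) \<delta>) (matrix_inv :: 'f^'m^'m \<Rightarrow> 'f^'m^'m)" for k
  proof (induction k)
    case 0
    then show ?case
      using D by (auto intro!: continuous_at_imp_continuous_on has_derivative_continuous)
  next
    case (Suc k)
    then show ?case
      by (intro ck_on_SucI[OF open_ball D] ck_on_bilinear[OF open_ball bounded_bilinear_matmul] ck_on_const
          ck_on_linear_comp[OF open_ball bounded_linear_minus[OF bounded_linear_ident]]) auto
  qed
  then show thesis
    using that[OF \<delta>] inv by (simp add: smooth_on_def)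
qed

section \<open>Traces of operators on matrices\<close>

lemma sum_Basis_vec:
  fixes F :: "'a::euclidean_space^'n \<Rightarrow> 'b::comm_monoid_add"
  shows "(\<Sum>b\<in>Basis. F b) = (\<Sum>i\<in>UNIV. \<Sum>u\<in>Basis. F (axis i u))"
proof -
  have inj: "inj_on (\<lambda>(i, u). axis i u :: 'a^'n) (UNIV \<times> Basis)"
    by (auto simp: inj_on_def axis_eq_axis nonzero_Basis)
  have im: "(Basis :: ('a^'n) set) = (\<lambda>(i, u). axis i u) ` (UNIV \<times> Basis)"
    by (auto simp: Basis_vec_def)
  show ?thesis
    unfolding im sum.reindex[OF inj] by (simp add: sum.cartesian_product split_def)
qed

text \<open>The trace of \<open>X \<mapsto> A X C\<close>. Hermitian \<open>A\<close> and \<open>C\<close> have real diagonal entries, which commute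
  with the scalars, and only the diagonal entries contribute.\<close>

lemma trace_two_sided_mult:
  fixes A C :: "'f::rch^'m^'m"
  assumes A: "ctranspose A = A" and C: "ctranspose C = C"
  shows "(\<Sum>b\<in>Basis. inner b (A ** b ** C)) = real DIM('f) * inner A (mat 1) * inner C (mat 1)"
proof -
  have d: "\<exists>t. M $ i $ i = t *\<^sub>R 1" if "ctranspose M = M" for M :: "'f^'m^'m" and i
    using arg_cong[OF that, of "\<lambda>M. M $ i $ i"] selfconjugate_real[of "M $ i $ i"]
    by (auto simp: ctranspose_def)
  have "\<forall>i. \<exists>t. A $ i $ i = t *\<^sub>R 1" "\<forall>i. \<exists>t. C $ i $ i = t *\<^sub>R 1"
    using d[OF A] d[OF C] by simp_all
  from this[THEN choice]
  obtain a c where a: "\<And>i. A $ i $ i = a i *\<^sub>R 1" and c: "\<And>i. C $ i $ i = c i *\<^sub>R 1"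
    by (elim exE) (rule that, simp_all)
  have tr: "inner A (mat 1) = (\<Sum>i\<in>UNIV. a i)" "inner C (mat 1) = (\<Sum>i\<in>UNIV. c i)"
    by (simp_all add: inner_vec_def mat_def if_distrib a c dot_square_norm cong: if_cong)
  have e: "inner (axis i (axis j q)) (A ** axis i (axis j q) ** C) = a i * c j"
    if "q \<in> Basis" for i j :: 'm and q :: 'f
  proof -
    have ax: "axis i (axis j q) $ k $ l = (if k = i then if l = j then q else 0 else 0)" for k l
      by (simp add: axis_def)
    have "(A ** axis i (axis j q)) $ i $ l = (if l = j then A $ i $ i * q else 0)" for l
      by (simp add: matrix_matrix_mult_def ax if_distrib[of "\<lambda>x. _ * x"] cong: if_cong)
    then have "(A ** axis i (axis j q) ** C) $ i $ j = A $ i $ i * q * C $ j $ j"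
      by (simp add: matrix_matrix_mult_def[of "A ** _"] if_distrib[of "\<lambda>x. x * _"] cong: if_cong)
    then show ?thesis
      using that by (simp add: inner_axis' a c inner_Basis)
  qed
  have "(\<Sum>b\<in>Basis. inner b (A ** b ** C)) = (\<Sum>i\<in>UNIV. \<Sum>j\<in>UNIV. \<Sum>q\<in>(Basis :: 'f set). a i * c j)"
    by (simp add: sum_Basis_vec e)
  also have "\<dots> = real DIM('f) * ((\<Sum>i\<in>UNIV. a i) * (\<Sum>j\<in>UNIV. c j))"
    unfolding sum_product by (simp add: sum_distrib_left mult_ac)
  also have "\<dots> = real DIM('f) * inner A (mat 1) * inner C (mat 1)"
    by (simp add: tr)
  finally show ?thesis .
qed

text \<open>Off-diagonal unit matrices are orthogonal to their adjoints; on the diagonal, conjugation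
  has trace \<open>2 - d\<close>, because it fixes the real line and negates its complement.\<close>

lemma trace_ctranspose:
  "(\<Sum>b\<in>(Basis :: ('f::rch^'m^'m) set). inner b (ctranspose b)) = real CARD('m) * (2 - real DIM('f))"
proof -
  have s: "(\<Sum>q\<in>(Basis :: 'f set). inner q (fcnj q)) = 2 - real DIM('f)"
  proof -
    have "(\<Sum>q\<in>(Basis :: 'f set). inner q (fcnj q))
        = (\<Sum>q\<in>(Basis :: 'f set). 2 * (inner 1 q * inner 1 q) - 1)"
      by (intro sum.cong refl) (simp add: fcnj_eq inner_diff_right inner_commute inner_Basis)
    also have "\<dots> = 2 - real DIM('f)"
      by (simp only: sum_subtractf sum_distrib_left[symmetric] euclidean_inner[symmetric])
        (simp add: dot_square_norm)
    finally show ?thesis .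
  qed
  have e: "inner (axis i (axis j q)) (ctranspose (axis i (axis j q))) =
      (if i = j then inner q (fcnj q) else 0)" for i j :: 'm and q :: 'f
    unfolding inner_axis' using fcnj_scaleR[of 0 "0 :: 'f"] by (simp add: ctranspose_def axis_def)
  have "(\<Sum>b\<in>(Basis :: ('f^'m^'m) set). inner b (ctranspose b)) =
      (\<Sum>i\<in>(UNIV :: 'm set). \<Sum>j\<in>UNIV. \<Sum>q\<in>(Basis :: 'f set). if i = j then inner q (fcnj q) else 0)"
    by (simp only: sum_Basis_vec e)
  also have "\<dots> = (\<Sum>i\<in>(UNIV :: 'm set). \<Sum>j\<in>UNIV. if i = j then 2 - real DIM('f) else 0)"
    by (intro sum.cong refl) (simp add: s)
  finally show ?thesis by simp
qed

text \<open>For an orthonormal family \<open>\<phi>\<close> the inner sum on the right is the orthogonal projection of \<open>b\<close>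
  onto the span, so that this is the basis independence of the trace.\<close>

lemma sum_inner_eq_trace:
  fixes \<phi> :: "'i \<Rightarrow> 'a::euclidean_space"
  assumes "linear L"
  shows "(\<Sum>c\<in>C. inner (\<phi> c) (L (\<phi> c))) = (\<Sum>b\<in>Basis. inner b (L (\<Sum>c\<in>C. inner b (\<phi> c) *\<^sub>R \<phi> c)))"
proof -
  have "(\<Sum>c\<in>C. inner (\<phi> c) (L (\<phi> c))) =
      (\<Sum>c\<in>C. \<Sum>b\<in>Basis. inner (\<phi> c) b * inner (L (\<phi> c)) b)"
    by (intro sum.cong refl euclidean_inner)
  also have "\<dots> = (\<Sum>b\<in>Basis. \<Sum>c\<in>C. inner (\<phi> c) b * inner (L (\<phi> c)) b)"
    by (rule sum.swap)
  also have "\<dots> = (\<Sum>b\<in>Basis. inner b (L (\<Sum>c\<in>C. inner b (\<phi> c) *\<^sub>R \<phi> c)))"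
    by (simp add: linear_sum[OF assms] linear_scale[OF assms] inner_sum_right inner_commute)
  finally show ?thesis .
qed

lemma orthonormal_basis_exists:
  assumes "subspace T"
  shows "\<exists>B. orthonormal_basis T B"
  using orthonormal_basis_subspace[OF assms] unfolding orthonormal_basis_def by metis

lemma orthonormal_basis_finite:
  assumes "orthonormal_basis T B"
  shows "finite B" and "card B = dim T"
proof -
  have "independent B"
    using assms by (intro pairwise_orthogonal_independent) (auto simp: orthonormal_basis_def)
  then show "finite B" "card B = dim T"
    using assms by (auto simp: orthonormal_basis_def independent_imp_finite dim_eq_card_independent
        dest: dim_span_eq_card_independent)
qed

lemma orthonormal_basis_expansion:
  assumes B: "orthonormal_basis T B" and x: "x \<in> T"
  shows "(\<Sum>e\<in>B. inner x e *\<^sub>R e) = x"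
proof -
  let ?y = "x - (\<Sum>e\<in>B. inner x e *\<^sub>R e)"
  have o: "inner c e = (if c = e then 1 else 0)" if "c \<in> B" "e \<in> B" for c e
    using B that by (auto simp: orthonormal_basis_def pairwise_def orthogonal_def norm_eq_1)
  have "orthogonal ?y e" if "e \<in> B" for e
    using that orthonormal_basis_finite(1)[OF B]
    by (simp add: orthogonal_def inner_diff_left inner_sum_left o if_distrib cong: if_cong)
  moreover have "?y \<in> span B"
  proof (intro span_diff span_sum span_scale)
    show "x \<in> span B" using B x by (simp add: orthonormal_basis_def)
  qed (rule span_base)
  ultimately have "orthogonal ?y ?y"
    using orthogonal_to_span by blast
  then show ?thesis by (simp add: orthogonal_def)
qed

section \<open>The space of Hermitian matrices\<close>

lemma bounded_linear_mat_of: "bounded_linear (mat_of :: ('f::rch, 'm::finite) herm \<Rightarrow> _)"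
  by (intro linear_conv_bounded_linear[THEN iffD1] linearI) simp_all

definition hermitian_part :: "'f::rch^'m^'m \<Rightarrow> ('f, 'm) herm"
  where "hermitian_part A = Herm ((1/2) *\<^sub>R (A + ctranspose A))"

lemma mat_of_hermitian_part: "mat_of (hermitian_part A) = (1/2) *\<^sub>R (A + ctranspose A)"
  unfolding hermitian_part_def by (rule Herm_inverse) (simp add: ctranspose_simps add.commute)

lemma mat_of_hermitian_part_id: "ctranspose A = A \<Longrightarrow> mat_of (hermitian_part A) = A"
  by (simp add: mat_of_hermitian_part flip: scaleR_2)

lemma hermitian_part_mat_of [simp]: "hermitian_part (mat_of X) = X"
  by (simp add: mat_of_inject[symmetric] mat_of_hermitian_part_id)

lemma bounded_linear_hermitian_part: "bounded_linear (hermitian_part :: 'f::rch^'m^'m \<Rightarrow> _)"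
  by (intro linear_conv_bounded_linear[THEN iffD1] linearI)
    (simp_all add: mat_of_inject[symmetric] mat_of_hermitian_part ctranspose_simps algebra_simps)

text \<open>Skew-Hermitian matrices are orthogonal to Hermitian ones; the factor 2 stems from the
  normalisation of the inner product on Hermitian matrices.\<close>

lemma inner_hermitian_part: "inner (hermitian_part A) X = inner A (mat_of X) / 2"
  using inner_ctranspose[of A "mat_of X"]
  by (simp add: inner_herm_eq mat_of_hermitian_part inner_add_left)

text \<open>Twice the dimension of the Hermitian matrices is the trace of \<open>b \<mapsto> b + b\<^sup>*\<close>, twice the
  projection onto them.\<close>

lemma dim_herm:
  "2 * dim (UNIV :: ('f::rch, 'm::finite) herm set) =
    2 * CARD('m) + DIM('f) * CARD('m) * (CARD('m) - 1)"
proof -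
  let ?B = "Basis :: ('f, 'm) herm set"
  have p: "(\<Sum>e\<in>?B. inner b (mat_of e) *\<^sub>R mat_of e) = b + ctranspose b" for b :: "'f^'m^'m"
  proof -
    have "mat_of (\<Sum>e\<in>?B. inner (hermitian_part b) e *\<^sub>R e) = (1/2) *\<^sub>R (b + ctranspose b)"
      by (simp add: euclidean_representation mat_of_hermitian_part)
    then have "(1/2) *\<^sub>R (\<Sum>e\<in>?B. inner b (mat_of e) *\<^sub>R mat_of e) = (1/2) *\<^sub>R (b + ctranspose b)"
      by (simp add: linear_sum[OF bounded_linear.linear[OF bounded_linear_mat_of]]
          inner_hermitian_part scaleR_sum_right)
    then show ?thesis by (simp only: scaleR_cancel_left) simp
  qed
  have "2 * real (dim (UNIV :: ('f, 'm) herm set)) = (\<Sum>e\<in>?B. 2 * inner e e)"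
    by (simp add: inner_Basis)
  also have "\<dots> = (\<Sum>e\<in>?B. inner (mat_of e) (mat_of e))"
    by (simp add: inner_herm_eq)
  also have "\<dots> = (\<Sum>b\<in>(Basis :: ('f^'m^'m) set). inner b (b + ctranspose b))"
    using sum_inner_eq_trace[OF linear_id, of mat_of ?B] by (simp add: p)
  also have "\<dots> = real (CARD('m) * (CARD('m) * DIM('f))) + real CARD('m) * (2 - real DIM('f))"
    by (simp add: inner_add_right sum.distrib trace_ctranspose inner_Basis)
  also have "\<dots> = real (2 * CARD('m) + DIM('f) * CARD('m) * (CARD('m) - 1))"
  proof -
    obtain k where k: "CARD('m) = Suc k"
      using not0_implies_Suc[of "CARD('m)"] by auto
    show ?thesis unfolding k by (simp add: algebra_simps)
  qed
  finally have "real (2 * dim (UNIV :: ('f, 'm) herm set)) =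
      real (2 * CARD('m) + DIM('f) * CARD('m) * (CARD('m) - 1))"
    by (simp only: of_nat_mult of_nat_numeral)
  then show ?thesis by (simp only: of_nat_eq_iff)
qed

lemma traceless_eq: "traceless = {X :: ('f::rch, 'm::finite) herm. inner X herm_id = 0}"
  by (simp add: traceless_def trace_hermitian inner_herm_eq)

lemma herm_id_nonzero: "(herm_id :: ('f::rch, 'm::finite) herm) \<noteq> 0"
proof
  assume "(herm_id :: ('f, 'm) herm) = 0"
  then have "(mat 1 :: 'f^'m^'m) = 0" using mat_of_herm_id mat_of_simps(1) by metis
  then have "(mat 1 :: 'f^'m^'m) $ undefined $ undefined = 0" by simp
  then show False by (simp add: mat_def)
qed

lemma inner_mat_1: "inner (mat 1 :: 'f::rch^'m^'m) (mat 1) = real CARD('m)"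
  by (simp add: inner_vec_def mat_def if_distrib dot_square_norm cong: if_cong)

lemma dim_orthogonal_complement_line:
  fixes p :: "'a::euclidean_space"
  assumes "subspace E" "p \<in> E" "p \<noteq> 0"
  shows "subspace {v \<in> E. inner v p = 0}" and "dim {v \<in> E. inner v p = 0} = dim E - 1"
proof -
  show "subspace {v \<in> E. inner v p = 0}"
    using assms(1) by (auto simp: subspace_def inner_add_left)
  have "{v \<in> E. inner v p = 0} = {y \<in> E. \<forall>x\<in>span {p}. orthogonal x y}"
    by (auto simp: orthogonal_def span_singleton inner_commute)
  moreover have "dim {y \<in> E. \<forall>x\<in>span {p}. orthogonal x y} + dim (span {p}) = dim E"
    by (rule dim_subspace_orthogonal_to_vectors[OF subspace_span assms(1) span_minimal])
      (use assms in simp_all)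
  moreover have "dim (span {p}) = 1"
    using assms(3) by simp
  ultimately show "dim {v \<in> E. inner v p = 0} = dim E - 1" by simp
qed

lemma traceless_subspace:
  shows "subspace (traceless :: ('f::rch, 'm::finite) herm set)"
    and "dim (traceless :: ('f, 'm) herm set) = dim (UNIV :: ('f, 'm) herm set) - 1"
  using dim_orthogonal_complement_line[OF subspace_UNIV, of "herm_id :: ('f, 'm) herm"]
  by (simp_all add: traceless_eq herm_id_nonzero)

section \<open>The sphere\<close>

text \<open>Stereographic projection from \<open>- p\<close> to the hyperplane orthogonal to \<open>p\<close> has smooth formulas
  in both directions, and the derivative of its inverse at 0 is a multiple of the identity, so
  that it yields the tangent space as well.\<close>

lemma sphere_chart:
  fixes p :: "'a::euclidean_space"
  assumes E: "subspace E" and r: "r > 0" and p: "p \<in> E \<inter> sphere 0 r"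
  defines "T \<equiv> {v \<in> E. inner v p = 0}"
  shows "\<exists>U V f. open U \<and> p \<in> U \<and> open V \<and> diffeo (V \<inter> T) (U \<inter> (E \<inter> sphere 0 r)) f"
    and "tangent_space (E \<inter> sphere 0 r) p = T"
proof -
  let ?S = "E \<inter> sphere 0 r"
  have pp: "inner p p = r\<^sup>2" using p by (simp add: dot_square_norm)
  have pE: "p \<in> E" using p by simp
  define f where "f v = inverse (r\<^sup>2 + inner v v) *\<^sub>R ((r\<^sup>2 - inner v v) *\<^sub>R p + (2 * r\<^sup>2) *\<^sub>R v)" for v
  define g where "g x = inverse (r\<^sup>2 + inner x p) *\<^sub>R (r\<^sup>2 *\<^sub>R x - inner x p *\<^sub>R p)" for x
  let ?U = "{x. r\<^sup>2 + inner x p \<noteq> 0}"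
  have r2: "r\<^sup>2 > 0" using r by simp
  have pos: "r\<^sup>2 + inner v v > 0" for v :: 'a
    using r2 inner_ge_zero[of v] by linarith
  have oU: "open ?U"
    by (intro open_Collect_neq continuous_intros)
  have oi: "open {x :: real. x \<noteq> 0}"
    by (rule open_Collect_neq) (auto intro: continuous_intros)
  have sf: "smooth_on UNIV f"
    unfolding f_def
    by (intro smooth_on_bilinear[OF _ bounded_bilinear_scaleR] smooth_on_compose[OF oi _ smooth_on_inverse]
        smooth_on_add smooth_on_diff smooth_on_const smooth_on_bilinear[OF _ bounded_bilinear_inner]
        smooth_on_ident open_UNIV) (use pos in \<open>auto simp: less_imp_neq[symmetric]\<close>)
  have sg: "smooth_on ?U g"
    unfolding g_def
    by (intro smooth_on_bilinear[OF _ bounded_bilinear_scaleR] smooth_on_compose[OF oi _ smooth_on_inverse]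
        smooth_on_add smooth_on_diff smooth_on_const smooth_on_bilinear[OF _ bounded_bilinear_inner]
        smooth_on_ident oU) auto
  have fS: "f v \<in> ?S" if "v \<in> T" for v
  proof -
    have v: "v \<in> E" "inner v p = 0" "inner p v = 0" using that by (auto simp: T_def inner_commute)
    have "inner (f v) (f v) = (inverse (r\<^sup>2 + inner v v))\<^sup>2 * ((r\<^sup>2 - inner v v)\<^sup>2 * r\<^sup>2 + (2 * r\<^sup>2)\<^sup>2 * inner v v)"
      by (simp add: f_def inner_add_left inner_add_right v pp power2_eq_square algebra_simps)
    also have "(r\<^sup>2 - inner v v)\<^sup>2 * r\<^sup>2 + (2 * r\<^sup>2)\<^sup>2 * inner v v = (r\<^sup>2 + inner v v)\<^sup>2 * r\<^sup>2"
      by (simp add: power2_eq_square algebra_simps)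
    also have "(inverse (r\<^sup>2 + inner v v))\<^sup>2 * ((r\<^sup>2 + inner v v)\<^sup>2 * r\<^sup>2) = r\<^sup>2"
      using pos[of v] by (simp add: power_inverse mult.assoc[symmetric] less_imp_neq[symmetric])
    finally have "norm (f v) = r"
      using r by (simp add: norm_eq_sqrt_inner)
    moreover have "f v \<in> E"
      unfolding f_def by (intro subspace_scale[OF E] subspace_add[OF E] v pE)
    ultimately show ?thesis by simp
  qed
  have gT: "g x \<in> T" if "x \<in> E" for x
    using that pE by (auto simp: T_def g_def inner_diff_left pp intro!: subspace_scale[OF E] subspace_diff[OF E])
  have gf: "g (f v) = v" if "v \<in> T" for v
  proof -
    define s where "s = r\<^sup>2 + inner v v"
    have v: "inner v p = 0" using that by (simp add: T_def)
    have s: "s > 0" "inner v v = s - r\<^sup>2" using pos[of v] by (simp_all add: s_def)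
    have 1: "inner (f v) p = r\<^sup>2 * (2 * r\<^sup>2 - s) / s"
    proof -
      have "inner (f v) p = inverse (r\<^sup>2 + inner v v) * ((r\<^sup>2 - inner v v) * r\<^sup>2)"
        by (simp add: f_def inner_add_left v pp)
      then show ?thesis by (simp add: s(2) divide_inverse)
    qed
    have 2: "r\<^sup>2 + inner (f v) p = 2 * r\<^sup>2 * r\<^sup>2 / s"
      using s(1) unfolding 1 by (simp add: field_simps power2_eq_square)
    have 3: "r\<^sup>2 *\<^sub>R f v - inner (f v) p *\<^sub>R p = (2 * r\<^sup>2 * r\<^sup>2 / s) *\<^sub>R v"
    proof -
      have fv: "f v = inverse s *\<^sub>R ((2 * r\<^sup>2 - s) *\<^sub>R p + (2 * r\<^sup>2) *\<^sub>R v)"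
        by (simp add: f_def s(2))
      show ?thesis unfolding 1 unfolding fv by (simp add: algebra_simps divide_inverse)
    qed
    show ?thesis
      unfolding g_def 2 3 using r s(1) by simp
  qed
  have fg: "f (g x) = x" if x: "x \<in> ?U" "x \<in> ?S" for x
  proof -
    define c where "c = inner x p"
    have xx: "inner x x = r\<^sup>2" using x(2) by (simp add: dot_square_norm)
    have c: "r\<^sup>2 + c \<noteq> 0" using x by (simp add: c_def)
    have "inner (g x) (g x) = (inverse (r\<^sup>2 + c))\<^sup>2 * (r\<^sup>2 * ((r\<^sup>2 - c) * (r\<^sup>2 + c)))"
      by (simp add: g_def c_def[symmetric] inner_diff_left inner_diff_right xx pp inner_commute[of p x]
          power2_eq_square algebra_simps)
    also have "\<dots> = r\<^sup>2 * (r\<^sup>2 - c) / (r\<^sup>2 + c)"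
    proof -
      have "(inverse t)\<^sup>2 * (x * (y * t)) = x * y / t" if "t \<noteq> 0" for t x y :: real
        using that by (simp add: power2_eq_square field_simps)
      then show ?thesis using c by blast
    qed
    finally have gg: "inner (g x) (g x) = r\<^sup>2 * (r\<^sup>2 - c) / (r\<^sup>2 + c)" .
    have 1: "r\<^sup>2 + inner (g x) (g x) = 2 * r\<^sup>2 * r\<^sup>2 / (r\<^sup>2 + c)"
      "r\<^sup>2 - inner (g x) (g x) = 2 * r\<^sup>2 * c / (r\<^sup>2 + c)"
      using c by (simp_all add: gg field_simps)
    have "(r\<^sup>2 - inner (g x) (g x)) *\<^sub>R p + (2 * r\<^sup>2) *\<^sub>R g x = (2 * r\<^sup>2 * r\<^sup>2 / (r\<^sup>2 + c)) *\<^sub>R x"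
      unfolding 1 unfolding g_def c_def[symmetric] by (simp add: algebra_simps divide_inverse)
    then show ?thesis
      unfolding f_def 1(1) using r c by simp
  qed
  have f0: "f 0 = p" using r2 by (simp add: f_def)
  have g0: "r\<^sup>2 + inner p p \<noteq> 0" using pos[of p] by simp
  show "\<exists>U V f. open U \<and> p \<in> U \<and> open V \<and> diffeo (V \<inter> T) (U \<inter> ?S) f"
    using submanifold_chartI[OF open_UNIV sf oU sg, of T ?S p] fS gT gf fg g0 by blast
  have D: "(f has_derivative (\<lambda>v. 2 *\<^sub>R v)) (at 0)"
    unfolding f_def using r
    by (auto intro!: derivative_eq_intros simp: fun_eq_iff power2_eq_square field_simps)
  show "tangent_space ?S p = T"
  proof
    show "T \<subseteq> tangent_space ?S p"
    proof
      fix v assume v: "v \<in> T"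
      have T: "subspace T"
        unfolding T_def by (rule dim_orthogonal_complement_line(1)[OF E pE]) (use pp r in auto)
      have "2 *\<^sub>R ((1/2) *\<^sub>R v) \<in> tangent_space ?S (f 0)"
        by (rule tangent_spaceI[OF open_UNIV sf _ T _ _ D]) (use v fS T in \<open>auto intro: subspace_scale\<close>)
      then show "v \<in> tangent_space ?S p" by (simp add: f0)
    qed
    show "tangent_space ?S p \<subseteq> T"
    proof
      fix v assume "v \<in> tangent_space ?S p"
      then obtain e \<gamma> where e: "e > 0" "\<gamma> ` {-e<..<e} \<subseteq> ?S" "\<gamma> 0 = p" "(\<gamma> has_vector_derivative v) (at 0)"
        unfolding tangent_space_def by blast
      have \<gamma>: "\<gamma> t \<in> E" "norm (\<gamma> t) = r" if "t \<in> {-e<..<e}" for t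
        using e(2) that by (auto simp: image_subset_iff)
      have in_kernel: "L v = 0" if L: "bounded_linear L" "\<And>x. x \<in> E \<Longrightarrow> L x = 0" for L :: "'a \<Rightarrow> real"
      proof -
        have "((\<lambda>t. L (\<gamma> t)) has_vector_derivative L v) (at 0)"
          by (rule bounded_linear.has_vector_derivative[OF L(1) e(4)])
        moreover have "((\<lambda>t. L (\<gamma> t)) has_vector_derivative 0) (at 0)"
          by (rule has_vector_derivative_transform_within_open[of "\<lambda>t. 0" _ _ "{-e<..<e}"])
            (use e(1) L(2) \<gamma>(1) in auto)
        ultimately show ?thesis by (rule vector_derivative_unique_at)
      qed
      have "v \<in> E"
      proof (rule ccontr)
        assume "v \<notin> E"
        obtain y z where yz: "y \<in> span E" "\<And>w. w \<in> span E \<Longrightarrow> orthogonal z w" "v = y + z"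
          using orthogonal_subspace_decomp_exists by blast
        have "inner z v = 0"
          by (rule in_kernel[OF bounded_linear_inner_right])
            (use yz(2) in \<open>auto simp: orthogonal_def span_base\<close>)
        then have "z = 0"
          using yz by (simp add: inner_add_right orthogonal_def)
        then show False
          using yz \<open>v \<notin> E\<close> E by (simp add: span_eq_iff[THEN iffD2])
      qed
      moreover have "inner v p = 0"
      proof -
        have "((\<lambda>t. inner (\<gamma> t) (\<gamma> t)) has_vector_derivative (inner (\<gamma> 0) v + inner v (\<gamma> 0))) (at 0)"
          by (rule bounded_bilinear.has_vector_derivative[OF bounded_bilinear_inner e(4) e(4)])
        moreover have "((\<lambda>t. inner (\<gamma> t) (\<gamma> t)) has_vector_derivative 0) (at 0)"
          by (rule has_vector_derivative_transform_within_open[of "\<lambda>t. r\<^sup>2" _ _ "{-e<..<e}"])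
            (use e(1) \<gamma>(2) in \<open>auto simp: dot_square_norm\<close>)
        ultimately have "inner (\<gamma> 0) v + inner v (\<gamma> 0) = 0" by (rule vector_derivative_unique_at)
        then show ?thesis by (simp add: e(3) inner_commute)
      qed
      ultimately show "v \<in> T" by (simp add: T_def)
    qed
  qed
qed

lemma submanifold_sphere:
  assumes E: "subspace E" and r: "r > 0"
  shows "submanifold (dim E - 1) (E \<inter> sphere 0 r)"
  unfolding submanifold_def
proof
  fix p assume p: "p \<in> E \<inter> sphere 0 r"
  then have "p \<in> E" "p \<noteq> 0" using r by auto
  note T = dim_orthogonal_complement_line[OF E this]
  obtain U V f where ch: "open U" "p \<in> U" "open V"
    "diffeo (V \<inter> {v \<in> E. inner v p = 0}) (U \<inter> (E \<inter> sphere 0 r)) f"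
    using sphere_chart(1)[OF E r p] by (elim exE conjE) (rule that)
  show "\<exists>U V (T :: 'a set) f. open U \<and> p \<in> U \<and> open V \<and> subspace T \<and> dim T = dim E - 1 \<and>
      diffeo (V \<inter> T) (U \<inter> (E \<inter> sphere 0 r)) f"
    by (rule exI[of _ U], rule exI[of _ V], rule exI[of _ "{v \<in> E. inner v p = 0}"], rule exI[of _ f])
      (intro conjI ch T)
qed

section \<open>Charts of the Grassmannian\<close>

lemma grassmannian_iff:
  fixes P :: "('f::rch, 'm::finite) herm"
  shows "P \<in> grassmannian n \<longleftrightarrow> mat_of P ** mat_of P = mat_of P \<and> inner (mat_of P) (mat 1) = real n"
proof -
  have "(of_nat n :: 'f) = real n *\<^sub>R 1"
    by (simp add: of_real_def[symmetric])
  then show ?thesis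
    by (simp add: grassmannian_def trace_hermitian)
qed

text \<open>In block form with respect to the range of \<open>P\<close> and its orthogonal complement, these are the
  Hermitian matrices whose diagonal blocks vanish.\<close>

definition grassmannian_tangent :: "('f::rch, 'm::finite) herm \<Rightarrow> ('f, 'm) herm set"
  where "grassmannian_tangent P = {Z. mat_of P ** mat_of Z + mat_of Z ** mat_of P = mat_of Z}"

definition offdiag :: "'f::rch^'m^'m \<Rightarrow> 'f^'m^'m \<Rightarrow> 'f^'m^'m"
  where "offdiag p x = p ** x ** (mat 1 - p) + (mat 1 - p) ** x ** p"

lemma subspace_grassmannian_tangent: "subspace (grassmannian_tangent P)"
  by (auto simp: grassmannian_tangent_def subspace_def matalg algebra_simps simp flip: scaleR_add_right)

lemma ctranspose_offdiag:
  "ctranspose p = p \<Longrightarrow> ctranspose (offdiag p x) = offdiag p (ctranspose x)"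
  by (simp add: offdiag_def ctranspose_simps matalg add.commute)

lemma offdiag_tangent:
  fixes p x :: "'f::rch^'m^'m"
  assumes "p ** p = p"
  shows "p ** offdiag p x + offdiag p x ** p = offdiag p x"
proof -
  have "p ** (p ** X) = p ** X" for X :: "'f^'m^'m" using assms by (simp add: matrix_mul_assoc)
  then show ?thesis using assms by (simp add: offdiag_def matalg)
qed

lemma offdiag_of_tangent:
  fixes p z :: "'f::rch^'m^'m"
  assumes "p ** p = p" "p ** z + z ** p = z"
  shows "offdiag p z = z"
proof -
  have pz: "p ** z = z - z ** p" using assms(2) by (simp add: algebra_simps)
  have "p ** (z ** X) = z ** X - z ** (p ** X)" for X :: "'f^'m^'m"
    using arg_cong[OF pz, of "\<lambda>A. A ** X"] by (simp add: matalg)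
  then show ?thesis using assms(1) pz by (simp add: offdiag_def matalg)
qed

text \<open>The matrix \<open>F\<close> is the projector onto the range of \<open>(1 + z) p\<close>, the graph of \<open>z\<close> on the range
  of \<open>p\<close>: because the off-diagonal \<open>z\<close> satisfies \<open>p z p = 0\<close>, the numerator is \<open>(1 + z) p (1 + z)\<close>
  and its square is itself times \<open>1 + z\<^sup>2\<close>. The matrix \<open>1 + z\<^sup>2\<close> commutes with \<open>p\<close> and \<open>z\<close>, hence
  so does its inverse \<open>h\<close>, and all words in \<open>z\<close>, \<open>h\<close>, \<open>p\<close> have a normal form \<open>z\<^sup>i h\<^sup>j p\<^sup>k\<close> that
  decides the identities by rewriting.\<close>

lemma graph_projector:
  fixes p z h :: "'f::rch^'m^'m"
  assumes pp: "p ** p = p" and tan: "p ** z + z ** p = z"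
    and h: "(mat 1 + z ** z) ** h = mat 1" "h ** (mat 1 + z ** z) = mat 1"
  defines "F \<equiv> (p + z + z ** p ** z) ** h"
  shows "F ** F = F" and "offdiag p F = z ** h" and "mat 1 - (p - F) ** (p - F) = h"
    and "inner F (mat 1) = inner p (mat 1)"
    and "ctranspose p = p \<Longrightarrow> ctranspose z = z \<Longrightarrow> ctranspose F = F"
proof -
  have pz: "p ** z = z - z ** p" using tan by (simp add: algebra_simps)
  have pz': "p ** (z ** X) = z ** X - z ** (p ** X)" for X :: "'f^'m^'m"
    using arg_cong[OF pz, of "\<lambda>A. A ** X"] by (simp add: matalg)
  have pp': "p ** (p ** X) = p ** X" for X :: "'f^'m^'m" using pp by (simp add: matrix_mul_assoc)
  have hz: "h ** z = z ** h" and ph: "p ** h = h ** p"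
    using inverse_commute[OF h, of z] inverse_commute[OF h, of p] by (simp_all add: matalg pz pz')
  have hz': "h ** (z ** X) = z ** (h ** X)" and ph': "p ** (h ** X) = h ** (p ** X)" for X :: "'f^'m^'m"
    using hz ph by (simp_all add: matrix_mul_assoc)
  have zzh: "z ** (z ** h) = mat 1 - h"
    using h(1) by (simp add: matalg algebra_simps)
  have zzh': "z ** (z ** (h ** X)) = X - h ** X" for X :: "'f^'m^'m"
    using arg_cong[OF zzh, of "\<lambda>A. A ** X"] by (simp add: matalg)
  note rules = matalg pz pz' pp pp' hz hz' ph ph' zzh zzh'
  show "F ** F = F" "mat 1 - (p - F) ** (p - F) = h" "offdiag p F = z ** h"
    unfolding F_def offdiag_def by (simp_all add: rules)
  \<comment> \<open>By cyclicity the real trace sees only diagonal blocks, and \<open>z h\<close> is off-diagonal.\<close>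
  have 0: "inner (z ** h) (mat 1) = 0"
  proof -
    have a: "inner (p ** (z ** h)) (mat 1) = 0" if "p ** (z ** (p ** h)) = 0"
    proof -
      have "inner (p ** (p ** (z ** h))) (mat 1) = inner (p ** (z ** h) ** p) (mat 1)"
        by (rule real_trace_cyclic)
      also have "p ** (z ** h) ** p = p ** (z ** (p ** h))"
        by (simp add: rules)
      finally show ?thesis by (simp add: pp' that)
    qed
    have b: "inner (z ** h ** p) (mat 1) = inner (p ** (z ** h)) (mat 1)"
      by (rule real_trace_cyclic)
    have "z ** h = p ** (z ** h) + z ** h ** p" by (simp add: rules)
    moreover have "p ** (z ** (p ** h)) = 0" by (simp add: rules)
    ultimately show ?thesis using a b by (metis add_0 inner_add_left)
  qed
  have "inner (z ** (p ** z ** h)) (mat 1) = inner (p ** z ** h ** z) (mat 1)"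
    by (rule real_trace_cyclic)
  also have "p ** z ** h ** z = p - h ** p" by (simp add: rules)
  finally have 1: "inner (z ** (p ** z ** h)) (mat 1) = inner p (mat 1) - inner (h ** p) (mat 1)"
    by (simp add: inner_diff_left)
  have "F = h ** p + z ** h + z ** (p ** z ** h)" by (simp add: F_def rules)
  then show "inner F (mat 1) = inner p (mat 1)"
    by (simp add: inner_add_left 0 1)
  show "ctranspose F = F" if "ctranspose p = p" "ctranspose z = z"
  proof -
    have "ctranspose h = h"
      by (rule ctranspose_inverse[OF h]) (simp add: ctranspose_simps that)
    then show ?thesis
      unfolding F_def by (simp add: ctranspose_simps that rules)
  qed
qed

text \<open>Conversely, the matrix \<open>1 - (p - x)\<^sup>2\<close> equals \<open>p x p + (1 - p) (1 - x) (1 - p)\<close>; it commutes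
  with both projectors, and it is invertible for \<open>x\<close> near \<open>p\<close>. It plays the role of \<open>h\<close> above, so
  that dividing the off-diagonal part of \<open>x\<close> by it recovers \<open>z\<close>.\<close>

lemma projector_is_graph:
  fixes p x e :: "'f::rch^'m^'m"
  assumes pp: "p ** p = p" and xx: "x ** x = x"
    and e: "(mat 1 - (p - x) ** (p - x)) ** e = mat 1" "e ** (mat 1 - (p - x) ** (p - x)) = mat 1"
  defines "z \<equiv> offdiag p x ** e"
  shows "p ** z + z ** p = z" and "mat 1 + z ** z = e"
    and "(p + z + z ** p ** z) ** (mat 1 - (p - x) ** (p - x)) = x"
    and "ctranspose p = p \<Longrightarrow> ctranspose x = x \<Longrightarrow> ctranspose z = z"
proof -
  have pp': "p ** (p ** X) = p ** X" and xx': "x ** (x ** X) = x ** X" for X :: "'f^'m^'m"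
    using pp xx by (simp_all add: matrix_mul_assoc)
  have pe: "p ** e = e ** p" and xe: "x ** e = e ** x"
    using inverse_commute[OF e, of p] inverse_commute[OF e, of x] by (simp_all add: matalg pp xx pp' xx')
  have pe': "p ** (e ** X) = e ** (p ** X)" and xe': "x ** (e ** X) = e ** (x ** X)" for X :: "'f^'m^'m"
    using pe xe by (simp_all add: matrix_mul_assoc)
  \<comment> \<open>The equation \<open>e (1 - (p - x)\<^sup>2) = 1\<close>, solved for the word \<open>e x p\<close>, shortens every longer word that
    contains \<open>e\<close>.\<close>
  have xp: "e ** (x ** p) = mat 1 - e + e ** p + e ** x - e ** (p ** x)"
    using e(2) by (simp add: matalg pp xx algebra_simps)
  have xp': "e ** (x ** (p ** X)) = X - e ** X + e ** (p ** X) + e ** (x ** X) - e ** (p ** (x ** X))" for X :: "'f^'m^'m"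
    using arg_cong[OF xp, of "\<lambda>A. A ** X"] by (simp add: matalg)
  have pxp: "e ** (p ** (x ** p)) = p"
    using arg_cong[OF xp, of "\<lambda>A. p ** A"] by (simp add: matalg pe' pe pp pp')
  have pxp': "e ** (p ** (x ** (p ** X))) = p ** X" for X :: "'f^'m^'m"
    using arg_cong[OF pxp, of "\<lambda>A. A ** X"] by (simp add: matalg)
  note rules = matalg pp pp' xx xx' pe pe' xe xe' xp xp' pxp pxp'
  show "p ** z + z ** p = z" "mat 1 + z ** z = e"
    "(p + z + z ** p ** z) ** (mat 1 - (p - x) ** (p - x)) = x"
    unfolding z_def offdiag_def by (simp_all add: rules)
  show "ctranspose z = z" if "ctranspose p = p" "ctranspose x = x"
  proof -
    have "ctranspose e = e"
      by (rule ctranspose_inverse[OF e]) (simp add: ctranspose_simps that)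
    then show ?thesis
      unfolding z_def by (simp add: ctranspose_simps ctranspose_offdiag that) (simp add: offdiag_def matalg pe pe' xe xe')
  qed
qed

text \<open>The inverses are taken near the identity, where they are smooth; both denominators equal 1
  at the centre of the chart. The chart has the identity as derivative on the tangent space,
  because it differs from \<open>P + Z\<close> by terms of second order only.\<close>

lemma grassmannian_chart:
  fixes P :: "('f::rch, 'm::finite) herm"
  assumes P: "P \<in> grassmannian n"
  defines "T \<equiv> grassmannian_tangent P"
  obtains U V f where "open U" "P \<in> U" "open V" "diffeo (V \<inter> T) (U \<inter> grassmannian n) f"
    and "T \<subseteq> tangent_space (grassmannian n) P"
proof -
  obtain \<delta> where \<delta>: "\<delta> > 0" "smooth_on (ball (mat 1) \<delta>) (matrix_inv :: 'f^'m^'m \<Rightarrow> 'f^'m^'m)"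
    "\<And>A :: 'f^'m^'m. A \<in> ball (mat 1) \<delta> \<Longrightarrow> A ** matrix_inv A = mat 1 \<and> matrix_inv A ** A = mat 1"
    by (rule smooth_on_matrix_inv[where 'f='f and 'm='m]) (rule that; simp)
  define p where "p = mat_of P"
  have p: "p ** p = p" "ctranspose p = p" "inner p (mat 1) = real n"
    using P by (simp_all add: p_def grassmannian_iff)
  define q where "q Z = mat 1 + mat_of Z ** mat_of Z" for Z :: "('f, 'm) herm"
  define D where "D X = mat 1 - (p - mat_of X) ** (p - mat_of X)" for X :: "('f, 'm) herm"
  define f where "f Z = hermitian_part ((p + mat_of Z + mat_of Z ** p ** mat_of Z) ** matrix_inv (q Z))"
    for Z :: "('f, 'm) herm"
  define g where "g X = hermitian_part (offdiag p (mat_of X) ** matrix_inv (D X))" for X :: "('f, 'm) herm"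
  define V where "V = q -` ball (mat 1) \<delta>"
  define U where "U = D -` ball (mat 1) \<delta>"
  note lin = smooth_on_linear[OF _ bounded_linear_mat_of] and mul = smooth_on_bilinear[OF _ bounded_bilinear_matmul]
  have sq: "smooth_on UNIV q" and sD: "smooth_on UNIV D"
    unfolding q_def D_def
    by (intro smooth_on_add smooth_on_diff smooth_on_const mul lin smooth_on_ident open_UNIV)+
  have oV: "open V" and oU: "open U"
    unfolding V_def U_def using smooth_on_imp_continuous_on[OF sq] smooth_on_imp_continuous_on[OF sD]
    by (auto intro!: open_vimage)
  have sf: "smooth_on V f"
    unfolding f_def
    by (intro smooth_on_linear[OF _ bounded_linear_hermitian_part] mul smooth_on_add smooth_on_const lin
        smooth_on_ident smooth_on_compose[OF open_ball _ \<delta>(2)] smooth_on_subset[OF sq] oV)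
      (auto simp: V_def)
  have sg: "smooth_on U g"
    unfolding g_def offdiag_def
    by (intro smooth_on_linear[OF _ bounded_linear_hermitian_part] mul smooth_on_add smooth_on_const lin
        smooth_on_ident smooth_on_compose[OF open_ball _ \<delta>(2)] smooth_on_subset[OF sD] oU)
      (auto simp: U_def)
  have f: "mat_of (f Z) = (p + mat_of Z + mat_of Z ** p ** mat_of Z) ** matrix_inv (q Z)"
    "f Z \<in> grassmannian n" "offdiag p (mat_of (f Z)) = mat_of Z ** matrix_inv (q Z)"
    "D (f Z) = matrix_inv (q Z)"
    if Z: "Z \<in> V \<inter> T" for Z
  proof -
    have t: "p ** mat_of Z + mat_of Z ** p = mat_of Z"
      using Z by (simp add: T_def grassmannian_tangent_def p_def)
    have i: "(mat 1 + mat_of Z ** mat_of Z) ** matrix_inv (q Z) = mat 1"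
      "matrix_inv (q Z) ** (mat 1 + mat_of Z ** mat_of Z) = mat 1"
      using Z \<delta>(3)[of "q Z"] by (simp_all add: V_def q_def)
    note G = graph_projector[OF p(1) t i]
    show 1: "mat_of (f Z) = (p + mat_of Z + mat_of Z ** p ** mat_of Z) ** matrix_inv (q Z)"
      unfolding f_def by (rule mat_of_hermitian_part_id[OF G(5)]) (simp_all add: p)
    show "f Z \<in> grassmannian n" using G(1,4) by (simp add: grassmannian_iff 1 p)
    show "offdiag p (mat_of (f Z)) = mat_of Z ** matrix_inv (q Z)" using G(2) by (simp add: 1)
    show "D (f Z) = matrix_inv (q Z)" using G(3) by (simp add: D_def 1)
  qed
  have gf: "g (f Z) = Z" if Z: "Z \<in> V \<inter> T" for Z
  proof -
    have i: "q Z ** matrix_inv (q Z) = mat 1" "matrix_inv (q Z) ** q Z = mat 1"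
      using Z \<delta>(3)[of "q Z"] by (simp_all add: V_def)
    have "offdiag p (mat_of (f Z)) ** matrix_inv (D (f Z)) = mat_of Z"
      using i by (simp add: f(3,4)[OF Z] matrix_inv_eqI[OF i(2,1)] flip: matrix_mul_assoc)
    then show ?thesis by (simp add: g_def)
  qed
  have g: "g X \<in> T" "q (g X) = matrix_inv (D X)" "f (g X) = X"
    if X: "X \<in> U \<inter> grassmannian n" for X
  proof -
    have x: "mat_of X ** mat_of X = mat_of X" using X by (simp add: grassmannian_iff)
    have i: "D X ** matrix_inv (D X) = mat 1" "matrix_inv (D X) ** D X = mat 1"
      using X \<delta>(3)[of "D X"] by (simp_all add: U_def)
    note G = projector_is_graph[OF p(1) x i[unfolded D_def[of X]]]
    have 1: "mat_of (g X) = offdiag p (mat_of X) ** matrix_inv (D X)"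
      unfolding g_def D_def by (rule mat_of_hermitian_part_id[OF G(4)]) (simp_all add: p)
    show "g X \<in> T"
      using G(1) by (simp add: T_def grassmannian_tangent_def 1 D_def flip: p_def)
    show 2: "q (g X) = matrix_inv (D X)"
      using G(2) by (simp add: q_def 1 D_def)
    have "(p + mat_of (g X) + mat_of (g X) ** p ** mat_of (g X)) ** matrix_inv (q (g X)) = mat_of X"
      unfolding 2 matrix_inv_eqI[OF i(2,1)] unfolding 1 D_def by (rule G(3))
    then show "f (g X) = X" by (simp add: f_def)
  qed
  have DP: "D P = mat 1" by (simp add: D_def p_def)
  have PU: "P \<in> U" by (simp add: U_def DP \<delta>(1))
  have "matrix_inv (mat 1 :: 'f^'m^'m) = mat 1" by (rule matrix_inv_eqI) simp_all
  then have inv1: "matrix_inv (D P) = mat 1" by (simp add: DP)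
  have gP: "g P = 0"
    using p(1) by (simp add: g_def inv1 offdiag_def matalg flip: p_def)
      (metis hermitian_part_mat_of mat_of_simps(1))
  have V0: "0 \<in> V" by (simp add: V_def q_def \<delta>(1))
  have f0: "f 0 = P" using g(3)[of P] PU P gP by simp
  have ch: "\<exists>U V. open U \<and> P \<in> U \<and> open V \<and> diffeo (V \<inter> T) (U \<inter> grassmannian n) f"
    using f(2) g gf gP V0 by (intro submanifold_chartI[OF oV sf oU sg _ _ _ _ PU]) auto
  have dm: "(mat_of has_derivative mat_of) (at (0 :: ('f, 'm) herm))"
    using bounded_linear_mat_of by (rule bounded_linear_imp_has_derivative)
  have dq: "(q has_derivative (\<lambda>v. 0)) (at 0)"
    unfolding q_def
    by (rule has_derivative_eq_rhs[OF has_derivative_add[OF has_derivative_const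
            matmul.FDERIV[OF dm dm]]]) simp
  have di: "((\<lambda>Z. matrix_inv (q Z)) has_derivative (\<lambda>v. 0)) (at 0)"
  proof -
    have "(matrix_inv has_derivative frechet_derivative matrix_inv (at (q 0))) (at (q 0))"
      by (rule smooth_on_has_derivative[OF \<delta>(2)]) (simp add: q_def \<delta>(1))
    from diff_chain_at[OF dq this] linear_0[OF has_derivative_linear[OF this]]
    show ?thesis by (simp add: o_def)
  qed
  have Df: "(f has_derivative (\<lambda>Z. hermitian_part (mat_of Z))) (at 0)"
    unfolding f_def
    by (rule has_derivative_eq_rhs[OF bounded_linear.has_derivative[OF bounded_linear_hermitian_part
            matmul.FDERIV[OF has_derivative_add[OF has_derivative_add[OF has_derivative_const dm]
              matmul.FDERIV[OF matmul.FDERIV[OF dm has_derivative_const] dm]] di]]])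
      (simp add: q_def fun_eq_iff \<open>matrix_inv (mat 1) = mat 1\<close> hermitian_part_mat_of)
  have "T \<subseteq> tangent_space (grassmannian n) P"
  proof
    fix Z assume Z: "Z \<in> T"
    have "hermitian_part (mat_of Z) \<in> tangent_space (grassmannian n) (f 0)"
      by (rule tangent_spaceI[OF oV sf V0 _ Z f(2) Df])
        (simp_all add: T_def subspace_grassmannian_tangent)
    then show "Z \<in> tangent_space (grassmannian n) P" by (simp add: f0)
  qed
  then show thesis using ch that by blast
qed

section \<open>Tangent spaces of the Grassmannian\<close>

lemma hermitian_part_offdiag_tangent:
  fixes P :: "('f::rch, 'm::finite) herm"
  assumes "mat_of P ** mat_of P = mat_of P"
  shows "hermitian_part (offdiag (mat_of P) (mat_of X)) \<in> grassmannian_tangent P"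
  by (simp add: grassmannian_tangent_def mat_of_hermitian_part_id ctranspose_offdiag
      offdiag_tangent[OF assms])

lemma tangent_block:
  fixes p e q :: "'f::rch^'m^'m"
  assumes pp: "p ** p = p" and tan: "p ** e + e ** p = e"
  shows "e ** (mat 1 - p) = p ** e ** (mat 1 - p)" "p ** e = p ** e ** (mat 1 - p)"
proof -
  have pe: "p ** e = e - e ** p" using tan by (simp add: algebra_simps)
  have pe': "p ** (e ** X) = e ** X - e ** (p ** X)" for X :: "'f^'m^'m"
    using arg_cong[OF pe, of "\<lambda>A. A ** X"] by (simp add: matalg)
  show "e ** (mat 1 - p) = p ** e ** (mat 1 - p)" "p ** e = p ** e ** (mat 1 - p)"
    by (simp_all add: matalg pe pe' pp)
qed

text \<open>A tangent vector is determined by its upper right block \<open>p e (1 - p)\<close>, and passing to this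
  block is an isometry from the tangent space onto the space of all such blocks. The sum is thus
  the trace of \<open>X \<mapsto> A X C\<close> on the blocks, which is the trace of \<open>X \<mapsto> A p X (1 - p) C\<close> on all
  matrices. With \<open>A\<close> and \<open>C\<close> equal to the identity this gives the dimension of the Grassmannian;
  with one of them replaced by a normal vector it gives minimality.\<close>

lemma sum_tangent_basis:
  fixes P :: "('f::rch, 'm::finite) herm" and A C :: "'f^'m^'m"
  assumes pp: "mat_of P ** mat_of P = mat_of P"
    and B: "orthonormal_basis (grassmannian_tangent P) B"
    and A: "ctranspose A = A" "A ** mat_of P = mat_of P ** A"
    and C: "ctranspose C = C" "C ** mat_of P = mat_of P ** C"
  defines "block X \<equiv> mat_of P ** X ** (mat 1 - mat_of P)"
  shows "(\<Sum>e\<in>B. inner (block (mat_of e)) (A ** block (mat_of e) ** C)) =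
    real DIM('f) * inner (A ** mat_of P) (mat 1) * inner (C ** (mat 1 - mat_of P)) (mat 1)"
proof -
  define p where "p = mat_of P"
  have cp: "ctranspose p = p" and pp: "p ** p = p" using pp by (simp_all add: p_def)
  have pp': "p ** (p ** X) = p ** X" for X :: "'f^'m^'m" using pp by (simp add: matrix_mul_assoc)
  have block: "block X = p ** X ** (mat 1 - p)" for X by (simp add: block_def p_def)
  have bl: "linear block"
    unfolding block_def by (intro linearI) (simp_all add: matalg algebra_simps)
  have adj: "inner (block X) Y = inner X (block Y)" for X Y
    by (simp add: block inner_matmul_left[of p] inner_matmul_right[of X] inner_matmul_right[of "p ** X"] cp ctranspose_simps matrix_mul_assoc)
  have L: "linear (\<lambda>X. A ** X ** C)"
    by (intro linearI) (simp_all add: matalg)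
  have proj: "(\<Sum>e\<in>B. inner b (block (mat_of e)) *\<^sub>R block (mat_of e)) = block b" for b
  proof -
    \<comment> \<open>The tangent vector with upper right block \<open>block b\<close>; expanding it in the basis \<open>B\<close> and
      taking blocks gives the expansion of \<open>block b\<close>.\<close>
    define y where "y = hermitian_part (2 *\<^sub>R block b)"
    have my: "mat_of y = block b + ctranspose (block b)"
      by (simp add: y_def mat_of_hermitian_part ctranspose_simps scaleR_add_right)
    have "y \<in> grassmannian_tangent P"
      by (simp add: grassmannian_tangent_def my block flip: p_def)
        (simp add: ctranspose_simps cp matalg pp pp')
    from orthonormal_basis_expansion[OF B this]
    have "block (mat_of y) = block (mat_of (\<Sum>e\<in>B. inner y e *\<^sub>R e))" by simp
    also have "\<dots> = (\<Sum>e\<in>B. inner b (block (mat_of e)) *\<^sub>R block (mat_of e))"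
      by (simp add: linear_sum[OF bounded_linear.linear[OF bounded_linear_mat_of]]
          linear_sum[OF bl] linear_scale[OF bl] y_def inner_hermitian_part adj)
    also have "block (mat_of y) = block b"
      unfolding my by (simp add: block ctranspose_simps cp matalg pp pp')
    finally show ?thesis by simp
  qed
  have "(\<Sum>e\<in>B. inner (block (mat_of e)) (A ** block (mat_of e) ** C)) =
      (\<Sum>b\<in>Basis. inner b (A ** block b ** C))"
    using sum_inner_eq_trace[OF L, of "\<lambda>e. block (mat_of e)" B] by (simp only: proj)
  also have "\<dots> = (\<Sum>b\<in>Basis. inner b ((A ** p) ** b ** ((mat 1 - p) ** C)))"
    by (simp add: block matrix_mul_assoc)
  also have "\<dots> = real DIM('f) * inner (A ** p) (mat 1) * inner ((mat 1 - p) ** C) (mat 1)"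
    by (rule trace_two_sided_mult) (use A C in \<open>simp_all add: ctranspose_simps cp matalg p_def\<close>)
  also have "inner ((mat 1 - p) ** C) (mat 1) = inner (C ** (mat 1 - p)) (mat 1)"
    by (rule real_trace_cyclic)
  finally show ?thesis by (simp add: p_def)
qed

text \<open>The two nonzero blocks of \<open>e\<close> are adjoint to each other, hence of equal norm, and they are
  orthogonal.\<close>

lemma norm_tangent_block:
  fixes p e :: "'f::rch^'m^'m"
  assumes pp: "p ** p = p" and tan: "p ** e + e ** p = e" and c: "ctranspose p = p" "ctranspose e = e"
  shows "2 * inner (p ** e ** (mat 1 - p)) (p ** e ** (mat 1 - p)) = inner e e"
proof -
  define Z where "Z = p ** e ** (mat 1 - p)"
  have e: "e = Z + ctranspose Z"
  proof -
    have "p ** e = Z" using tangent_block(2)[OF pp tan] by (simp add: Z_def)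
    moreover from this have "e ** p = ctranspose Z"
      using ctranspose_simps(4)[of p e] c by simp
    ultimately show ?thesis using tan by simp
  qed
  have "inner Z (ctranspose Z) = inner (p ** Z) (ctranspose Z)"
    by (simp add: Z_def matrix_mul_assoc pp)
  also have "\<dots> = inner Z (p ** ctranspose Z)"
    by (simp add: inner_matmul_left c)
  also have "p ** ctranspose Z = 0"
    by (simp add: Z_def ctranspose_simps c matrix_mul_assoc matmul.diff_left matmul.diff_right pp)
  finally have "inner Z (ctranspose Z) = 0" by simp
  then have "inner e e = 2 * inner Z Z"
    unfolding e by (simp add: inner_add_left inner_add_right inner_ctranspose inner_commute)
  then show ?thesis by (simp add: Z_def)
qed

lemma dim_grassmannian_tangent:
  fixes P :: "('f::rch, 'm::finite) herm"
  assumes P: "P \<in> grassmannian n"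
  shows "dim (grassmannian_tangent P) = DIM('f) * n * (CARD('m) - n)"
proof -
  let ?p = "mat_of P"
  have p: "?p ** ?p = ?p" "inner ?p (mat 1) = real n" using P by (simp_all add: grassmannian_iff)
  obtain B where B: "orthonormal_basis (grassmannian_tangent P) B"
    using orthonormal_basis_exists[OF subspace_grassmannian_tangent] by blast
  have "inner (?p ** mat_of e ** (mat 1 - ?p)) (?p ** mat_of e ** (mat 1 - ?p)) = 1" if "e \<in> B" for e
  proof -
    have "e \<in> grassmannian_tangent P" "inner e e = 1"
      using B that by (auto simp: orthonormal_basis_def norm_eq_1)
    then show ?thesis
      using norm_tangent_block[OF p(1), of "mat_of e"]
      by (simp add: grassmannian_tangent_def inner_herm_eq)
  qed
  then have "real (card B) = real DIM('f) * real n * (real CARD('m) - real n)"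
    using sum_tangent_basis[OF p(1) B, of "mat 1" "mat 1"]
    by (simp add: ctranspose_simps p inner_diff_left inner_mat_1)
  moreover have "real n \<le> real CARD('m)"
  proof -
    have "inner (mat 1 - ?p) (mat 1) = inner (mat 1 - ?p) (mat 1 - ?p)"
      using inner_matmul_left[of ?p ?p "mat 1"]
      by (simp add: inner_diff_left inner_diff_right inner_commute[of "mat 1" ?p] p)
    then have "0 \<le> inner (mat 1 - ?p) (mat 1)" by (simp only: inner_ge_zero)
    then show ?thesis by (simp add: inner_diff_left inner_mat_1 p)
  qed
  ultimately have "real (card B) = real (DIM('f) * n * (CARD('m) - n))"
    by (simp add: of_nat_diff)
  then show ?thesis
    using orthonormal_basis_finite(2)[OF B] by (simp only: of_nat_eq_iff)
qed

lemma submanifold_grassmannian: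
  "submanifold (DIM('f) * n * (CARD('m) - n)) (grassmannian n :: ('f::rch, 'm::finite) herm set)"
  unfolding submanifold_def
proof
  fix P :: "('f, 'm) herm" assume P: "P \<in> grassmannian n"
  obtain U V f where ch: "open U" "P \<in> U" "open V"
    "diffeo (V \<inter> grassmannian_tangent P) (U \<inter> grassmannian n) f"
    by (rule grassmannian_chart[OF P])
  show "\<exists>U V (T :: ('f, 'm) herm set) f. open U \<and> P \<in> U \<and> open V \<and> subspace T \<and>
      dim T = DIM('f) * n * (CARD('m) - n) \<and> diffeo (V \<inter> T) (U \<inter> grassmannian n) f"
    by (rule exI[of _ U], rule exI[of _ V], rule exI[of _ "grassmannian_tangent P"], rule exI[of _ f])
      (intro conjI ch subspace_grassmannian_tangent dim_grassmannian_tangent P)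
qed

text \<open>One inclusion comes from the chart, the other from differentiating \<open>P\<^sup>2 = P\<close> along a curve.\<close>

lemma tangent_space_grassmannian:
  fixes P :: "('f::rch, 'm::finite) herm"
  assumes P: "P \<in> grassmannian n"
  shows "tangent_space (grassmannian n) P = grassmannian_tangent P"
proof
  show "grassmannian_tangent P \<subseteq> tangent_space (grassmannian n) P"
    by (rule grassmannian_chart[OF P])
  show "tangent_space (grassmannian n) P \<subseteq> grassmannian_tangent P"
  proof
    fix v assume "v \<in> tangent_space (grassmannian n) P"
    then obtain e \<gamma> where e: "e > 0" "\<gamma> ` {-e<..<e} \<subseteq> grassmannian n" "\<gamma> 0 = P"
      "(\<gamma> has_vector_derivative v) (at 0)"
      unfolding tangent_space_def by blast
    let ?m = "\<lambda>t. mat_of (\<gamma> t)"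
    have m: "(?m has_vector_derivative mat_of v) (at 0)"
      by (rule bounded_linear.has_vector_derivative[OF bounded_linear_mat_of e(4)])
    have "((\<lambda>t. ?m t ** ?m t) has_vector_derivative (?m 0 ** mat_of v + mat_of v ** ?m 0)) (at 0)"
      by (rule bounded_bilinear.has_vector_derivative[OF bounded_bilinear_matmul m m])
    moreover have "((\<lambda>t. ?m t ** ?m t) has_vector_derivative mat_of v) (at 0)"
      by (rule has_vector_derivative_transform_within_open[OF m, of "{-e<..<e}"])
        (use e(1,2) in \<open>auto simp: image_subset_iff grassmannian_iff\<close>)
    ultimately have "?m 0 ** mat_of v + mat_of v ** ?m 0 = mat_of v"
      by (rule vector_derivative_unique_at)
    then show "v \<in> grassmannian_tangent P"
      by (simp add: grassmannian_tangent_def e(3))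
  qed
qed

lemma tangent_space_translate:
  fixes a :: "'a::euclidean_space"
  shows "tangent_space ((\<lambda>x. x - a) ` M) (p - a) = tangent_space M p"
proof -
  have sub: "tangent_space M p \<subseteq> tangent_space ((\<lambda>x. x - a) ` M) (p - a)" for M and p a :: 'a
  proof
    fix v assume "v \<in> tangent_space M p"
    then obtain e \<gamma> where e: "e > 0" "smooth_on {-e<..<e} \<gamma>" "\<gamma> ` {-e<..<e} \<subseteq> M" "\<gamma> 0 = p"
      "(\<gamma> has_vector_derivative v) (at 0)"
      unfolding tangent_space_def by blast
    have "smooth_on {-e<..<e} (\<lambda>t. \<gamma> t - a)"
      by (intro smooth_on_diff smooth_on_const e(2)) auto
    moreover have "((\<lambda>t. \<gamma> t - a) has_vector_derivative v) (at 0)"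
      using e(5) by (auto intro!: derivative_eq_intros)
    ultimately show "v \<in> tangent_space ((\<lambda>x. x - a) ` M) (p - a)"
      unfolding tangent_space_def using e by (intro CollectI exI[of _ e] exI[of _ "\<lambda>t. \<gamma> t - a"]) auto
  qed
  have "tangent_space ((\<lambda>x. x - a) ` M) (p - a) \<subseteq> tangent_space M p"
    using sub[of "(\<lambda>x. x - a) ` M" "p - a" "- a"] by (simp add: image_image)
  with sub show ?thesis by blast
qed

section \<open>Minimality\<close>

lemma orth_proj:
  fixes T :: "'a::euclidean_space set"
  assumes T: "subspace T"
  shows "orth_proj T x \<in> T" and "w \<in> T \<Longrightarrow> inner (orth_proj T x) w = inner x w"
proof -
  obtain y z where yz: "y \<in> span T" "\<And>w. w \<in> span T \<Longrightarrow> orthogonal z w" "x = y + z"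
    using orthogonal_subspace_decomp_exists[of T x] by blast
  have s: "span T = T" using T by (simp add: span_eq_iff)
  have "orth_proj T x = y"
    unfolding orth_proj_def
  proof (rule the_equality)
    show "y \<in> T \<and> x - y \<in> T\<^sup>\<bottom>"
      using yz by (simp add: s orthogonal_comp_def orthogonal_commute)
    fix u assume u: "u \<in> T \<and> x - u \<in> T\<^sup>\<bottom>"
    have yu: "y - u \<in> T" using u yz(1) T by (simp add: s subspace_diff)
    then have "inner (y - u) (x - u) = 0" "inner (y - u) z = 0"
      using u yz(2)[of "y - u"]
      by (auto simp: orthogonal_comp_def s orthogonal_def inner_commute)
    then have "inner (y - u) (y - u) = 0"
      by (simp add: yz(3) inner_diff_right inner_add_right)
    then show "u = y" by simp
  qed
  then show "orth_proj T x \<in> T" "w \<in> T \<Longrightarrow> inner (orth_proj T x) w = inner x w"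
    using yz by (simp_all add: s inner_add_left orthogonal_def)
qed

lemma has_vector_derivative_compose_smooth:
  assumes "open U" "smooth_on U V" "\<gamma> 0 \<in> U" "(\<gamma> has_vector_derivative v) (at (0::real))"
  shows "((\<lambda>t. V (\<gamma> t)) has_vector_derivative frechet_derivative V (at (\<gamma> 0)) v) (at 0)"
proof -
  have D: "(V has_derivative frechet_derivative V (at (\<gamma> 0))) (at (\<gamma> 0))"
    by (rule smooth_on_has_derivative[OF assms(2,3)])
  show ?thesis
    using diff_chain_at[OF assms(4)[unfolded has_vector_derivative_def] D]
    by (simp add: has_vector_derivative_def o_def linear_scale[OF has_derivative_linear[OF D]])
qed

text \<open>This is the derivative of \<open>P V + V P = V\<close> along a curve with velocity \<open>e\<close>. The right-hand
  side depends on \<open>e\<close> only, which is why the choice of the field does not matter.\<close>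

lemma derivative_of_tangent_field:
  fixes P :: "('f::rch, 'm::finite) herm" and a :: "('f, 'm) herm"
  assumes P: "P \<in> grassmannian n" and e: "e \<in> grassmannian_tangent P"
    and V: "local_tangent_field ((\<lambda>X. X - a) ` grassmannian n) (P - a) V" "V (P - a) = e"
  defines "D \<equiv> mat_of (frechet_derivative V (at (P - a)) e)"
  shows "D - mat_of P ** D - D ** mat_of P = 2 *\<^sub>R (mat_of e ** mat_of e)"
proof -
  let ?M = "(\<lambda>X. X - a) ` grassmannian n"
  obtain U where U: "open U" "P - a \<in> U" "smooth_on U V" "\<And>x. x \<in> U \<inter> ?M \<Longrightarrow> V x \<in> tangent_space ?M x"
    using V(1) unfolding local_tangent_field_def by blast
  have "e \<in> tangent_space ?M (P - a)"
    using e P by (simp add: tangent_space_translate tangent_space_grassmannian)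
  then obtain d \<gamma> where d: "d > 0" "smooth_on {-d<..<d} \<gamma>" "\<gamma> ` {-d<..<d} \<subseteq> ?M" "\<gamma> 0 = P - a"
    "(\<gamma> has_vector_derivative e) (at 0)"
    unfolding tangent_space_def by blast
  let ?I = "{-d<..<d} \<inter> \<gamma> -` U"
  have oI: "open ?I"
    by (rule continuous_open_preimage[OF smooth_on_imp_continuous_on[OF d(2)] _ U(1)]) simp
  have I0: "0 \<in> ?I" using d(1,4) U(2) by simp
  let ?p = "\<lambda>t. mat_of (\<gamma> t + a)" and ?v = "\<lambda>t. mat_of (V (\<gamma> t))"
  have "((\<lambda>t. \<gamma> t + a) has_vector_derivative e) (at 0)"
    using d(5) by (auto intro!: derivative_eq_intros)
  then have dp: "(?p has_vector_derivative mat_of e) (at 0)"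
    by (rule bounded_linear.has_vector_derivative[OF bounded_linear_mat_of])
  have "((\<lambda>t. V (\<gamma> t)) has_vector_derivative frechet_derivative V (at (\<gamma> 0)) e) (at 0)"
    using U d by (intro has_vector_derivative_compose_smooth[of U]) auto
  then have dv: "(?v has_vector_derivative D) (at 0)"
    unfolding D_def d(4) by (rule bounded_linear.has_vector_derivative[OF bounded_linear_mat_of])
  have "((\<lambda>t. ?p t ** ?v t + ?v t ** ?p t) has_vector_derivative
      (?p 0 ** D + mat_of e ** ?v 0) + (?v 0 ** mat_of e + D ** ?p 0)) (at 0)"
    by (intro has_vector_derivative_add bounded_bilinear.has_vector_derivative[OF bounded_bilinear_matmul] dp dv)
  moreover have "((\<lambda>t. ?p t ** ?v t + ?v t ** ?p t) has_vector_derivative D) (at 0)"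
  proof (rule has_vector_derivative_transform_within_open[OF dv oI I0])
    fix t assume t: "t \<in> ?I"
    then have "\<gamma> t \<in> U \<inter> ?M" using d(3) by auto
    then obtain Q where Q: "Q \<in> grassmannian n" "\<gamma> t = Q - a" "V (\<gamma> t) \<in> tangent_space ?M (\<gamma> t)"
      using U(4) by blast
    then have "V (\<gamma> t) \<in> grassmannian_tangent Q"
      by (simp add: tangent_space_translate tangent_space_grassmannian)
    then show "?v t = ?p t ** ?v t + ?v t ** ?p t"
      by (simp add: grassmannian_tangent_def Q(2))
  qed
  ultimately have "(?p 0 ** D + mat_of e ** ?v 0) + (?v 0 ** mat_of e + D ** ?p 0) = D"
    by (rule vector_derivative_unique_at)
  then show ?thesis by (simp add: d(4) V(2) scaleR_2 algebra_simps)
qed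

text \<open>The off-diagonal part of the fixed matrix \<open>e\<close> with respect to a varying projector is
  polynomial in the projector and reproduces \<open>e\<close> at \<open>P\<close>.\<close>

lemma tangent_field_exists:
  fixes P a :: "('f::rch, 'm::finite) herm"
  assumes P: "P \<in> grassmannian n" and e: "e \<in> grassmannian_tangent P"
  shows "\<exists>V. local_tangent_field ((\<lambda>X. X - a) ` grassmannian n) (P - a) V \<and> V (P - a) = e"
proof (intro exI conjI)
  let ?V = "\<lambda>x. hermitian_part (offdiag (mat_of (x + a)) (mat_of e))"
  have "smooth_on UNIV ?V"
    unfolding offdiag_def
    by (intro smooth_on_linear[OF _ bounded_linear_hermitian_part] smooth_on_add smooth_on_diff
        smooth_on_bilinear[OF _ bounded_bilinear_matmul] smooth_on_const
        smooth_on_linear[OF _ bounded_linear_mat_of] smooth_on_ident open_UNIV)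
  moreover have "?V (Q - a) \<in> tangent_space ((\<lambda>X. X - a) ` grassmannian n) (Q - a)"
    if "Q \<in> grassmannian n" for Q
    using that hermitian_part_offdiag_tangent[of Q e]
    by (simp only: diff_add_cancel) (simp add: tangent_space_translate tangent_space_grassmannian grassmannian_iff)
  ultimately show "local_tangent_field ((\<lambda>X. X - a) ` grassmannian n) (P - a) ?V"
    unfolding local_tangent_field_def by (intro exI[of _ UNIV]) auto
  have "offdiag (mat_of P) (mat_of e) = mat_of e"
    using P e by (intro offdiag_of_tangent) (simp_all add: grassmannian_iff grassmannian_tangent_def)
  then show "?V (P - a) = e" by simp
qed

text \<open>The off-diagonal part of \<open>w\<close> is itself tangent, so it is orthogonal to \<open>w\<close> and must vanish.\<close>

lemma orthogonal_to_tangent_commutes: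
  fixes P w :: "('f::rch, 'm::finite) herm"
  assumes pp: "mat_of P ** mat_of P = mat_of P" and w: "w \<in> (grassmannian_tangent P)\<^sup>\<bottom>"
  shows "mat_of w ** mat_of P = mat_of P ** mat_of w"
proof -
  define p where "p = mat_of P"
  have p: "p ** p = p" "ctranspose p = p" using pp by (simp_all add: p_def)
  define Y where "Y = offdiag p (mat_of w)"
  have pp': "p ** (p ** X) = p ** X" for X :: "'f^'m^'m" using p by (simp add: matrix_mul_assoc)
  have cY: "ctranspose Y = Y" by (simp add: Y_def ctranspose_offdiag p)
  have "hermitian_part Y \<in> grassmannian_tangent P"
    unfolding Y_def p_def by (rule hermitian_part_offdiag_tangent[OF pp])
  then have "inner (hermitian_part Y) w = 0"
    using w by (auto simp: orthogonal_comp_def orthogonal_def)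
  then have "inner Y (mat_of w) = 0" by (simp add: inner_hermitian_part)
  moreover have "inner Y (mat_of w) = inner Y Y"
  proof -
    have a: "inner Y (p ** mat_of w ** p) = 0"
    proof -
      have "p ** Y ** p = 0" by (simp add: Y_def offdiag_def matalg p pp')
      then show ?thesis
        using inner_matmul_left[of p "Y ** p" "mat_of w"] inner_matmul_right[of Y p "p ** mat_of w"]
        by (simp add: p matrix_mul_assoc)
    qed
    have b: "inner Y ((mat 1 - p) ** mat_of w ** (mat 1 - p)) = 0"
    proof -
      have "(mat 1 - p) ** Y ** (mat 1 - p) = 0" by (simp add: Y_def offdiag_def matalg p pp')
      then show ?thesis
        using inner_matmul_left[of "mat 1 - p" "Y ** (mat 1 - p)" "mat_of w"]
          inner_matmul_right[of Y "mat 1 - p" "(mat 1 - p) ** mat_of w"]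
        by (simp add: p matrix_mul_assoc ctranspose_simps)
    qed
    have "mat_of w = Y + (p ** mat_of w ** p + (mat 1 - p) ** mat_of w ** (mat 1 - p))"
      by (simp add: Y_def offdiag_def matalg)
    then have "inner Y (mat_of w) =
        inner Y (Y + (p ** mat_of w ** p + (mat 1 - p) ** mat_of w ** (mat 1 - p)))"
      by (rule arg_cong)
    then show ?thesis by (simp only: inner_add_right a b)
  qed
  ultimately have "Y = 0" by simp
  then have "p ** Y = 0" "Y ** p = 0" by simp_all
  then show ?thesis by (simp add: Y_def offdiag_def matalg p pp' flip: p_def)
qed

text \<open>The equation for \<open>D\<close> fixes its diagonal blocks to be those of \<open>2 (1 - 2 p) e\<^sup>2\<close>, and \<open>w\<close>,
  which commutes with \<open>p\<close>, sees only these. The two blocks of \<open>e\<^sup>2\<close> are the products of \<open>Z\<close> and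
  its adjoint in either order, which brings the result into the form needed for the trace formula.\<close>

lemma inner_derivative_normal:
  fixes p D e w :: "'f::rch^'m^'m"
  assumes pp: "p ** p = p" and cp: "ctranspose p = p"
    and ce: "ctranspose e = e" and tan: "p ** e + e ** p = e"
    and cw: "ctranspose w = w" and wp: "w ** p = p ** w"
    and D: "D - p ** D - D ** p = 2 *\<^sub>R (e ** e)"
  defines "Z \<equiv> p ** e ** (mat 1 - p)"
  shows "inner D w = 2 * (inner Z (mat 1 ** Z ** w) - inner Z (w ** Z ** mat 1))"
proof -
  have pp': "p ** (p ** X) = p ** X" for X :: "'f^'m^'m" using pp by (simp add: matrix_mul_assoc)
  have wp': "w ** (p ** X) = p ** (w ** X)" for X :: "'f^'m^'m" using wp by (simp add: matrix_mul_assoc)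
  \<comment> \<open>The map \<open>X \<mapsto> X - p X - X p\<close> kills the off-diagonal blocks and changes the sign of the upper left one;
    multiplying \<open>w\<close> by \<open>1 - 2 p\<close> makes up for that sign.\<close>
  let ?u = "w - 2 *\<^sub>R (p ** w)"
  note tb = tangent_block[OF pp tan]
  have "inner D w = inner D (?u - p ** ?u - ?u ** p)"
    by (rule arg_cong[of _ _ "inner D"]) (simp add: matalg pp pp' wp wp' scaleR_2 algebra_simps)
  also have "\<dots> = inner (D - p ** D - D ** p) ?u"
    by (simp only: inner_diff_left inner_diff_right[of D _ "?u ** p"] inner_diff_right[of D _ "p ** ?u"]
        inner_matmul_left[of p D] inner_matmul_right[of D p] cp)
  also have "\<dots> = 2 * (inner (e ** e) ((mat 1 - p) ** w) - inner (e ** e) (p ** w))"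
    unfolding D by (simp add: inner_diff_right matalg)
  also have "inner (e ** e) ((mat 1 - p) ** w) = inner Z (mat 1 ** Z ** w)"
  proof -
    have "inner (e ** e) ((mat 1 - p) ** w) = inner e (e ** (mat 1 - p) ** w)"
      by (simp add: inner_matmul_left ce matrix_mul_assoc)
    also have "e ** (mat 1 - p) ** w = p ** (Z ** w ** (mat 1 - p))"
      unfolding Z_def by (subst tb(1)) (simp add: matalg pp pp' wp wp')
    also have "inner e (p ** (Z ** w ** (mat 1 - p))) = inner Z (Z ** w)"
      unfolding Z_def
      by (simp add: inner_matmul_left[of p] inner_matmul_right[of _ "mat 1 - p"] ctranspose_simps cp ce matrix_mul_assoc)
    finally show ?thesis by simp
  qed
  also have "inner (e ** e) (p ** w) = inner Z (w ** Z ** mat 1)"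
  proof -
    have "inner (e ** e) (p ** w) = inner e (p ** w ** e)"
      by (simp add: inner_matmul_right[of e e] ce matrix_mul_assoc)
    also have "p ** w ** e = p ** (w ** Z ** (mat 1 - p))"
    proof -
      have "p ** w ** e = w ** (p ** e)" by (simp add: matrix_mul_assoc wp)
      also have "\<dots> = w ** Z" unfolding Z_def tb(2)[symmetric] ..
      also have "\<dots> = p ** (w ** Z ** (mat 1 - p))"
        by (simp add: Z_def matalg pp pp' wp wp')
      finally show ?thesis .
    qed
    also have "inner e (p ** (w ** Z ** (mat 1 - p))) = inner Z (w ** Z)"
      unfolding Z_def
      by (simp add: inner_matmul_left[of p] inner_matmul_right[of _ "mat 1 - p"] ctranspose_simps cp ce matrix_mul_assoc)
    finally show ?thesis by simp
  qed
  finally show ?thesis .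
qed

lemma grassmannian_norm:
  fixes P :: "('f::rch, 'm::finite) herm"
  assumes P: "P \<in> grassmannian n"
  shows "norm (P - (real n / real CARD('m)) *\<^sub>R herm_id) = sqrt (real n * (real CARD('m) - real n) / (2 * real CARD('m)))"
    and "P - (real n / real CARD('m)) *\<^sub>R herm_id \<in> traceless"
proof -
  have p: "mat_of P ** mat_of P = mat_of P" "inner (mat_of P) (mat 1) = real n"
    using P by (simp_all add: grassmannian_iff)
  have pp: "inner (mat_of P) (mat_of P) = real n"
    using inner_matmul_left[of "mat_of P" "mat_of P" "mat 1"] by (simp add: p)
  have "inner (P - (real n / real CARD('m)) *\<^sub>R herm_id) (P - (real n / real CARD('m)) *\<^sub>R herm_id)
      = real n * (real CARD('m) - real n) / (2 * real CARD('m))"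
    by (simp add: inner_herm_eq inner_diff_left inner_diff_right pp p(2) inner_mat_1
        inner_commute[of "mat 1" "mat_of P"] field_simps)
  then show "norm (P - (real n / real CARD('m)) *\<^sub>R herm_id) = sqrt (real n * (real CARD('m) - real n) / (2 * real CARD('m)))"
    by (simp add: norm_eq_sqrt_inner)
  show "P - (real n / real CARD('m)) *\<^sub>R herm_id \<in> traceless"
    by (simp add: traceless_eq inner_herm_eq inner_diff_left p inner_mat_1)
qed

text \<open>A vector \<open>w\<close> that is normal to the Grassmannian in the sphere is traceless and orthogonal to
  \<open>P - c I\<close>, so the real traces of \<open>w P\<close> and \<open>w (1 - P)\<close> are both zero; these are the only
  quantities through which the sum of the second fundamental form over an orthonormal basis pairs
  with \<open>w\<close>.\<close>

lemma minimal_grassmannian: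
  fixes n :: nat
  defines "c \<equiv> real n / real CARD('m)"
    and "r \<equiv> sqrt (real n * (real CARD('m) - real n) / (2 * real CARD('m)))"
  assumes n: "0 < n" "n < CARD('m::finite)"
  shows "minimal_submanifold (traceless \<inter> sphere 0 r)
    ((\<lambda>P. P - c *\<^sub>R herm_id) ` (grassmannian n :: ('f::rch, 'm) herm set))"
  unfolding minimal_submanifold_def
proof (intro conjI ballI)
  let ?S = "traceless \<inter> sphere 0 r :: ('f, 'm) herm set"
  let ?a = "c *\<^sub>R herm_id :: ('f, 'm) herm"
  let ?M = "(\<lambda>P. P - ?a) ` grassmannian n"
  have r: "r > 0" using n by (simp add: r_def)
  show "\<exists>k. submanifold k ?S"
    using submanifold_sphere[OF traceless_subspace(1) r] by blast
  show "\<exists>k. submanifold k ?M"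
    using submanifold_affinity[OF submanifold_grassmannian, where c = 1 and a = "- ?a"] by auto
  show "?M \<subseteq> ?S"
    using grassmannian_norm by (auto simp: c_def r_def)
  fix x assume "x \<in> ?M"
  then obtain P where P: "P \<in> grassmannian n" "x = P - ?a" by blast
  have xS: "x \<in> ?S" using \<open>x \<in> ?M\<close> \<open>?M \<subseteq> ?S\<close> by blast
  define p where "p = mat_of P"
  have p: "p ** p = p" "ctranspose p = p" using P by (simp_all add: p_def grassmannian_iff)
  have TM: "tangent_space ?M x = grassmannian_tangent P"
    using P by (simp add: tangent_space_translate tangent_space_grassmannian)
  have TS: "tangent_space ?S x = {v \<in> traceless. inner v x = 0}"
    by (rule sphere_chart(2)[OF traceless_subspace(1) r xS])
  have sTS: "subspace (tangent_space ?S x)"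
    unfolding TS using xS r by (intro dim_orthogonal_complement_line(1) traceless_subspace(1)) auto
  let ?N = "normal_space ?S ?M x"
  have sN: "subspace ?N"
    unfolding normal_space_def by (intro subspace_inter sTS subspace_orthogonal_comp)
  define B where "B = (SOME B. orthonormal_basis (tangent_space ?M x) B)"
  have B: "orthonormal_basis (grassmannian_tangent P) B"
    unfolding B_def TM by (rule someI_ex[OF orthonormal_basis_exists[OF subspace_grassmannian_tangent]])
  have BT: "e \<in> grassmannian_tangent P" if "e \<in> B" for e
    using B that by (auto simp: orthonormal_basis_def)
  define V where "V e = (SOME V. local_tangent_field ?M x V \<and> V x = e)" for e
  define D where "D e = frechet_derivative (V e) (at x) e" for e
  have V: "local_tangent_field ?M x (V e)" "V e x = e" if "e \<in> B" for e
    using someI_ex[OF tangent_field_exists[OF P(1) BT[OF that], of ?a]] by (simp_all add: V_def P(2))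
  let ?II = "\<lambda>e. second_fundamental_form ?S ?M x e e"
  have II: "?II e \<in> ?N" "w \<in> ?N \<Longrightarrow> inner (?II e) w = inner (D e) w" for e w
  proof -
    have eq: "?II e = orth_proj ?N (orth_proj (tangent_space ?S x) (D e))"
      by (simp add: second_fundamental_form_def covariant_derivative_def D_def V_def)
    show "?II e \<in> ?N" unfolding eq by (rule orth_proj(1)[OF sN])
    show "inner (?II e) w = inner (D e) w" if "w \<in> ?N"
      unfolding eq orth_proj(2)[OF sN that]
      by (rule orth_proj(2)[OF sTS]) (use that in \<open>simp add: normal_space_def\<close>)
  qed
  define H where "H = (\<Sum>e\<in>B. ?II e)"
  have HN: "H \<in> ?N"
    unfolding H_def by (intro subspace_sum[OF sN] II(1))
  have "inner H w = 0" if w: "w \<in> ?N" for w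
  proof -
    define W where "W = mat_of w"
    have cW: "ctranspose W = W" by (simp add: W_def)
    have wP: "W ** p = p ** W"
      unfolding W_def p_def
      by (rule orthogonal_to_tangent_commutes) (use w p in \<open>auto simp: normal_space_def TM p_def\<close>)
    have wt: "inner W (mat 1) = 0" "inner W p = 0"
    proof -
      have "w \<in> tangent_space ?S x" using w by (simp add: normal_space_def)
      then have "w \<in> traceless" "inner w x = 0" by (simp_all only: TS mem_Collect_eq)
      then have "inner w herm_id = 0" "inner w x = 0" by (simp_all add: traceless_eq)
      then show "inner W (mat 1) = 0" "inner W p = 0"
        by (simp_all add: W_def p_def P(2) inner_diff_right inner_herm_eq)
    qed
    have wp: "inner (W ** p) (mat 1) = 0"
      using wt(2) by (simp add: inner_matmul_right p)
    have wq: "inner (W ** (mat 1 - p)) (mat 1) = 0"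
      using wp wt(1) by (simp add: matalg inner_diff_left)
    have De: "inner (D e) w = inner (p ** mat_of e ** (mat 1 - p)) (mat 1 ** (p ** mat_of e ** (mat 1 - p)) ** W)
        - inner (p ** mat_of e ** (mat 1 - p)) (W ** (p ** mat_of e ** (mat 1 - p)) ** mat 1)" if e: "e \<in> B" for e
    proof -
      have t: "p ** mat_of e + mat_of e ** p = mat_of e"
        using BT[OF e] by (simp add: grassmannian_tangent_def p_def)
      have "mat_of (D e) - p ** mat_of (D e) - mat_of (D e) ** p = 2 *\<^sub>R (mat_of e ** mat_of e)"
        unfolding D_def p_def P(2)
        by (rule derivative_of_tangent_field[OF P(1) BT[OF e]]) (use V[OF e] P(2) in simp_all)
      from inner_derivative_normal[OF p _ t cW wP this] show ?thesis
        by (simp add: inner_herm_eq W_def)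
    qed
    have "inner H w = (\<Sum>e\<in>B. inner (D e) w)"
      unfolding H_def inner_sum_left by (intro sum.cong refl II(2) w)
    also have "\<dots> = (\<Sum>e\<in>B. inner (p ** mat_of e ** (mat 1 - p)) (mat 1 ** (p ** mat_of e ** (mat 1 - p)) ** W))
        - (\<Sum>e\<in>B. inner (p ** mat_of e ** (mat 1 - p)) (W ** (p ** mat_of e ** (mat 1 - p)) ** mat 1))"
      unfolding sum_subtractf[symmetric] by (intro sum.cong refl De)
    also have "\<dots> = 0"
    proof -
      note sums = sum_tangent_basis[OF p(1)[unfolded p_def] B, folded p_def]
      have "ctranspose (mat 1 :: 'f^'m^'m) = mat 1" by (rule ctranspose_simps(6))
      then show ?thesis
        using sums[of "mat 1" W] sums[of W "mat 1"] cW wP wp wq by simp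
    qed
    finally show ?thesis .
  qed
  from this[OF HN] have "H = 0" by simp
  then show "mean_curvature ?S ?M x = 0"
    by (simp add: mean_curvature_def H_def B_def)
qed

section \<open>The two opposite embeddings\<close>

lemma smooth_embedding_affinity:
  fixes a :: "'a::euclidean_space"
  assumes "submanifold k M" "submanifold l S" "c \<noteq> 0" "(\<lambda>x. a + c *\<^sub>R x) ` M \<subseteq> S"
  shows "smooth_embedding M S (\<lambda>x. a + c *\<^sub>R x)"
  unfolding smooth_embedding_def
  using assms submanifold_affinity[OF assms(1,3)] diffeo_affinity[OF assms(3)] by blast

lemma perp_grassmannian:
  fixes P :: "('f::rch, 'm::finite) herm"
  assumes "P \<in> grassmannian n" "n \<le> CARD('m)"
  shows "perp P \<in> grassmannian (CARD('m) - n)"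
  using assms by (simp add: grassmannian_iff perp_def matalg inner_diff_left inner_mat_1 of_nat_diff)

lemma perp_image_grassmannian:
  assumes "n \<le> CARD('m::finite)"
  shows "perp ` grassmannian n = (grassmannian (CARD('m) - n) :: ('f::rch, 'm) herm set)"
proof
  show "perp ` grassmannian n \<subseteq> (grassmannian (CARD('m) - n) :: ('f, 'm) herm set)"
    using perp_grassmannian[OF _ assms] by blast
  show "(grassmannian (CARD('m) - n) :: ('f, 'm) herm set) \<subseteq> perp ` grassmannian n"
  proof
    fix Q :: "('f, 'm) herm" assume "Q \<in> grassmannian (CARD('m) - n)"
    then have "perp Q \<in> grassmannian n"
      using perp_grassmannian[of Q "CARD('m) - n"] assms by simp
    then show "Q \<in> perp ` grassmannian n"
      by (rule rev_image_eqI) (simp add: perp_def)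
  qed
qed

lemma cone_over_uminus: "cone_over (uminus ` A) = uminus ` cone_over A"
  by (force simp: cone_over_def)

lemma cone_over_subset: "subspace E \<Longrightarrow> A \<subseteq> E \<Longrightarrow> cone_over A \<subseteq> E"
  by (auto simp: cone_over_def subspace_scale)

theorem theorem3p1:
  fixes n m d N :: nat and r :: real
    and \<iota> \<iota>' \<kappa> :: "('f::rch, 'm::finite) herm \<Rightarrow> ('f, 'm) herm"
  assumes "m = CARD('m)" and "d = DIM('f)"
    and "1 \<le> n" and "n \<le> m - 1"
    and "N = m + d * m * (m - 1) div 2"
    and "r = sqrt (real n * (real m - real n) / (2 * real m))"
    and "\<iota> = (\<lambda>P. P - (real n / real m) *\<^sub>R herm_id)"
    and "\<iota>' = (\<lambda>Q. Q - (real (m - n) / real m) *\<^sub>R herm_id)"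
    and "\<kappa> = (\<lambda>P. perp P - (real (m - n) / real m) *\<^sub>R herm_id)"
  shows
    "(dim (UNIV :: ('f, 'm) herm set) = N \<and>
      subspace (traceless :: ('f, 'm) herm set) \<and> dim (traceless :: ('f, 'm) herm set) = N - 1)
     \<and>
     (smooth_embedding (grassmannian n) (traceless \<inter> sphere 0 r) \<iota> \<and>
      smooth_embedding (grassmannian (m - n)) (traceless \<inter> sphere 0 r) \<iota>' \<and>
      minimal_submanifold (traceless \<inter> sphere 0 r) (\<iota> ` grassmannian n) \<and>
      minimal_submanifold (traceless \<inter> sphere 0 r) (\<iota>' ` grassmannian (m - n)) \<and>
      opposite (\<iota> ` grassmannian n) (\<iota>' ` grassmannian (m - n)))
     \<and>
     (smooth_embedding (grassmannian n) (traceless \<inter> sphere 0 r) \<kappa> \<and>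
      cone_over (\<iota> ` grassmannian n) \<subseteq> traceless \<and>
      cone_over (\<kappa> ` grassmannian n) \<subseteq> traceless \<and>
      opposite (cone_over (\<iota> ` grassmannian n)) (cone_over (\<kappa> ` grassmannian n)))"
proof -
  let ?G = "grassmannian :: nat \<Rightarrow> ('f, 'm) herm set"
  let ?S = "traceless \<inter> sphere 0 r :: ('f, 'm) herm set"
  have n: "0 < n" "n < m" "n \<le> CARD('m)" "m - n < m" "0 < m - n" "0 < m"
    using assms(1,3,4) by auto
  have r': "r = sqrt (real (m - n) * (real m - real (m - n)) / (2 * real m))"
    using n assms(6) by (simp add: of_nat_diff mult.commute)
  have r: "r > 0" using n assms(6) by simp
  have k: "\<kappa> P = - \<iota> P" "\<kappa> P = \<iota>' (perp P)" for P
  proof -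
    have c: "real (m - n) / real m = 1 - real n / real m"
      using n by (simp add: of_nat_diff field_simps)
    show "\<kappa> P = - \<iota> P"
      unfolding assms(7,9) perp_def c by (simp add: algebra_simps)
    show "\<kappa> P = \<iota>' (perp P)"
      by (simp add: assms(8,9))
  qed
  have kG: "\<kappa> ` ?G n = uminus ` \<iota> ` ?G n"
    by (simp add: image_image k(1))
  have "\<kappa> ` ?G n = \<iota>' ` perp ` ?G n"
    by (simp add: image_image k(2))
  then have iG: "\<iota>' ` ?G (m - n) = uminus ` \<iota> ` ?G n"
    using perp_image_grassmannian[OF n(3), where 'f='f] kG assms(1) by simp
  define R where "R j = sqrt (real j * (real m - real j) / (2 * real m))" for j
  have R: "R n = r" "R (m - n) = r" by (simp_all only: R_def assms(6) r'[symmetric])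
  have "(\<lambda>P. P - (real j / real m) *\<^sub>R herm_id) ` ?G j \<subseteq> traceless \<inter> sphere 0 (R j)" for j
    using grassmannian_norm[of _ j, where 'f='f and 'm='m] by (auto simp: R_def assms(1))
  from this[of n] this[of "m - n"]
  have in_S: "\<iota> ` ?G n \<subseteq> ?S" "\<iota>' ` ?G (m - n) \<subseteq> ?S"
    by (simp_all only: R assms(7,8))
  then have kS: "\<kappa> ` ?G n \<subseteq> ?S"
    by (simp add: kG iG)
  have subm: "submanifold (DIM('f) * j * (m - j)) (?G j)" for j
    unfolding assms(1) by (rule submanifold_grassmannian)
  note sphere = submanifold_sphere[OF traceless_subspace(1)[where 'f='f and 'm='m] r]
  have emb: "smooth_embedding (?G n) ?S \<iota>" "smooth_embedding (?G (m - n)) ?S \<iota>'"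
    "smooth_embedding (?G n) ?S \<kappa>"
  proof -
    show "smooth_embedding (?G n) ?S \<iota>"
      using smooth_embedding_affinity[OF subm sphere, where c = 1 and a = "- (real n / real m) *\<^sub>R herm_id"] in_S
      by (simp add: assms(7))
    show "smooth_embedding (?G (m - n)) ?S \<iota>'"
      using smooth_embedding_affinity[OF subm sphere, where c = 1 and a = "- (real (m - n) / real m) *\<^sub>R herm_id"] in_S
      by (simp add: assms(8))
    have "\<kappa> = (\<lambda>P. (real n / real m) *\<^sub>R herm_id + (- 1) *\<^sub>R P)"
      by (simp add: fun_eq_iff k(1)) (simp add: assms(7))
    then show "smooth_embedding (?G n) ?S \<kappa>"
      using smooth_embedding_affinity[OF subm sphere, where c = "- 1" and a = "(real n / real m) *\<^sub>R herm_id"] kS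
      by simp
  qed
  have "minimal_submanifold (traceless \<inter> sphere 0 (R j)) ((\<lambda>P. P - (real j / real m) *\<^sub>R herm_id) ` ?G j)"
    if "0 < j" "j < m" for j
    unfolding R_def assms(1) by (rule minimal_grassmannian) (use that assms(1) in simp_all)
  from this[OF n(1,2)] this[OF n(5,4)]
  have mini: "minimal_submanifold ?S (\<iota> ` ?G n)" "minimal_submanifold ?S (\<iota>' ` ?G (m - n))"
    by (simp_all only: R assms(7,8))
  have dimN: "dim (UNIV :: ('f, 'm) herm set) = N"
  proof -
    have "x = y + z div 2" if "2 * x = 2 * y + z" for x y z :: nat
      using that by presburger
    from this[OF dim_herm] show ?thesis by (simp only: assms(1,2,5))
  qed
  have cones: "cone_over (\<iota> ` ?G n) \<subseteq> traceless" "cone_over (\<kappa> ` ?G n) \<subseteq> traceless"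
    by (rule cone_over_subset[OF traceless_subspace(1)], use in_S kS in blast)+
  have opp: "opposite (\<iota> ` ?G n) (\<iota>' ` ?G (m - n))"
    "opposite (cone_over (\<iota> ` ?G n)) (cone_over (\<kappa> ` ?G n))"
    by (simp_all add: opposite_def iG kG cone_over_uminus)
  have dimT: "dim (traceless :: ('f, 'm) herm set) = N - 1"
    by (simp only: traceless_subspace(2) dimN)
  show ?thesis
    by (intro conjI dimN dimT traceless_subspace(1) emb mini cones opp)
qed

end
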